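(* Let $\tau=\frac{1+\sqrt5}{2}$, and for real $\gamma\geqslant 2$ and $\Gamma\in(0,1)$ put $$g(\gamma)=\tau+\frac{2\tau-2}{\tau^2\gamma-2},\qquad C(\Gamma)=2^{18}\,\Gamma^{\frac{\tau-\tau^2}{\tau^2\gamma-2}}.$$ Let $\alpha_1,\alpha_2$ be real numbers. Suppose that for some $\Gamma\in(0,1)$ and some $\gamma\geqslant 2$ the inequality $$\|\alpha_1m_1+\alpha_2m_2\|\geqslant \frac{\Gamma}{(\max\{|m_1|,|m_2|\})^{\gamma}}$$ holds for all integer vectors $(m_1,m_2)\in\mathbb{Z}^2\setminus\{(0,0)\}$. Then there exists an infinite sequence of integer vectors $(x_1(i),x_2(i))\in\mathbb{Z}^2$ such that for all $i$: (1) $x_1(i)>0$ and $x_2(i)>0$; (2) $\|\alpha_1x_1(i)+\alpha_2x_2(i)\|\cdot(\max\{x_1(i),x_2(i)\})^{g(\gamma)}\leqslant C(\Gamma)$.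
   Context: For a real number $\xi$, $\|\xi\|$ denotes the distance from $\xi$ to the nearest integer. The constant $C(\Gamma)$ depends on both $\Gamma$ and $\gamma$ through the displayed formula. *)

theory Defs
  imports "HOL-Analysis.Analysis"
begin

definition dist_to_int :: "real \<Rightarrow> real" where
  "dist_to_int \<xi> = infdist \<xi> \<int>"

definition golden :: real where
  "golden = (1 + sqrt 5) / 2"

definition g :: "real \<Rightarrow> real" where
  "g \<gamma> = golden + (2 * golden - 2) / (golden\<^sup>2 * \<gamma> - 2)"

definition C :: "real \<Rightarrow> real \<Rightarrow> real" where
  "C \<gamma> \<Gamma> = 2 ^ 18 * \<Gamma> powr ((golden - golden\<^sup>2) / (golden\<^sup>2 * \<gamma> - 2))"

end

theory Submission
  imports Defs
begin

text \<open>
  Write \<open>L(z) = z0 + \<alpha> z1 + \<beta> z2\<close> and \<open>height z = max(|z1|, |z2|)\<close>. Let \<open>t\<close>, \<open>u\<close>, \<open>v\<close> be linearly independent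
  consecutive best approximations (they occur arbitrarily far out), \<open>X = height u\<close>, \<open>Y = height v\<close>,
  \<open>l = |L(u)|\<close>. There are two sources of points with positive coordinates. (B) As \<open>u\<close>, \<open>v\<close> extend to a basis of
  the lattice, a translate of the plane through them meets \<open>L = 0\<close> in a line at distance about \<open>1 / (l Y)\<close> from
  the origin, and rounding there gives size about \<open>1 / (l Y)\<close> and \<open>|L| \<le> l\<close>. (A) If neither \<open>u\<close> nor \<open>v\<close>
  already serves, both lie in the quadrants of mixed sign; either (B) succeeds or \<open>l Y\<^sup>2\<close> is small, and then the
  determinant of \<open>t\<close>, \<open>u\<close>, \<open>v\<close> forces \<open>|u1 v2 - u2 v1|\<close> to be at least about \<open>X\<^sup>2\<close>, so that some \<open>a u - 3 v\<close>
  with \<open>a\<close> about \<open>Y / X\<close> lies in a good quadrant; it has size about \<open>Y\<close> and \<open>|L|\<close> about \<open>l Y / X\<close>. Failure of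
  both, together with \<open>l \<ge> \<Gamma> / X powr \<gamma>\<close>, gives linear inequalities between the logarithms of \<open>l\<close>, \<open>X\<close>, \<open>Y\<close>,
  which are contradictory because \<open>e = g \<gamma>\<close> satisfies \<open>e\<^sup>2 - e - 1 \<le> e / \<gamma>\<close>.
\<close>

section \<open>Best approximations of a linear form\<close>

text \<open>The first coordinate is left out: it only plays the integer against which the distance
  is measured.\<close>

definition height :: "int \<times> int \<times> int \<Rightarrow> int" where
  "height = (\<lambda>(a, b, c). max \<bar>b\<bar> \<bar>c\<bar>)"

lemma height_simp [simp]: "height (a, b, c) = max \<bar>b\<bar> \<bar>c\<bar>"
  by (simp add: height_def)

lemma height_nonneg: "height z \<ge> 0"
  by (cases z rule: prod_cases3) auto

text \<open>The assumption is linear independence of 1, \<alpha>, \<beta> over the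
  rationals.\<close>

locale linear_form =
  fixes \<alpha> \<beta> :: real
  assumes nonvanishing:
    "(b, c) \<noteq> (0, 0) \<Longrightarrow> real_of_int a + \<alpha> * of_int b + \<beta> * of_int c \<noteq> 0"
begin

definition L :: "int \<times> int \<times> int \<Rightarrow> real" where
  "L = (\<lambda>(a, b, c). of_int a + \<alpha> * of_int b + \<beta> * of_int c)"

lemma L_simp [simp]: "L (a, b, c) = of_int a + \<alpha> * of_int b + \<beta> * of_int c"
  by (simp add: L_def)

lemma L_nonzero: "z \<noteq> (0, 0, 0) \<Longrightarrow> L z \<noteq> 0"
proof (cases z rule: prod_cases3)
  case (fields a b c)
  then show "z \<noteq> (0, 0, 0) \<Longrightarrow> L z \<noteq> 0"
    using nonvanishing[of b c a] by (cases "(b, c) = (0, 0)") auto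
qed

text \<open>Pigeonhole on the fractional parts of \<open>N^2\<close> values. The height bound is
  strict so that \<open>z\<close> can be tested directly against the minimality clause of
  \<open>consec\<close>.\<close>

lemma dirichlet:
  fixes N :: nat
  assumes "N \<ge> 2"
  shows "\<exists>z. z \<noteq> (0, 0, 0) \<and> height z < int N \<and> \<bar>L z\<bar> * real N ^ 2 \<le> 2"
proof -
  \<comment> \<open>One box fewer than points. The value is then below \<open>1 / (N^2 - 1)\<close>,
    which is at most \<open>2 / N^2\<close> for \<open>N >= 2\<close>; hence the constant 2.\<close>
  define K where "K = N ^ 2 - 1"
  have N4: "N ^ 2 \<ge> 4" using power_mono[OF assms, of 2] by simp
  have K: "real K = real N ^ 2 - 1" "K > 0"
    using N4 by (auto simp: K_def of_nat_diff)
  define x where "x = (\<lambda>(i :: nat, j :: nat). \<alpha> * real i + \<beta> * real j)"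
  define f where "f = (\<lambda>p. \<lfloor>real K * frac (x p)\<rfloor>)"
  define A where "A = {..<N} \<times> {..<N}"
  have "f ` A \<subseteq> {0..<int K}"
  proof safe
    fix a b
    have "0 \<le> frac (x (a, b))" "frac (x (a, b)) < 1" by (auto simp: frac_lt_1)
    then have "0 \<le> real K * frac (x (a, b))" "real K * frac (x (a, b)) < real K"
      using K by auto
    then show "f (a, b) \<in> {0..<int K}" by (auto simp: f_def floor_less_iff)
  qed
  then have "card (f ` A) \<le> K" using card_mono[of "{0..<int K}"] by force
  also have "K < card A" using K(2) by (simp add: A_def K_def power2_eq_square)
  finally have "\<not> inj_on f A" by (rule pigeonhole)
  then obtain i j i' j' where ij: "(i, j) \<in> A" "(i', j') \<in> A" "(i, j) \<noteq> (i', j')"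
    "f (i, j) = f (i', j')" unfolding inj_on_def by auto
  define z where "z = (\<lfloor>x (i', j')\<rfloor> - \<lfloor>x (i, j)\<rfloor>, int i - int i', int j - int j')"
  have "L z = frac (x (i, j)) - frac (x (i', j'))"
    by (simp add: z_def x_def frac_def algebra_simps)
  then have "real K * L z = real K * frac (x (i, j)) - real K * frac (x (i', j'))"
    by (simp only: right_diff_distrib)
  moreover have "\<bar>real K * frac (x (i, j)) - real K * frac (x (i', j'))\<bar> < 1"
    using ij(4) unfolding f_def by linarith
  ultimately have "real K * \<bar>L z\<bar> < 1" by (simp add: abs_mult)
  moreover have "real N ^ 2 \<le> 2 * real K" using N4 K(1)
    using power_mono[of 2 "real N" 2] assms by simp
  ultimately have "\<bar>L z\<bar> * real N ^ 2 \<le> 2"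
    using mult_left_mono[of "real N ^ 2" "2 * real K" "\<bar>L z\<bar>"] by (simp add: mult_ac)
  moreover have "z \<noteq> (0, 0, 0)" using ij(3) by (auto simp: z_def)
  moreover have "height z < int N" using ij(1,2) by (auto simp: z_def A_def)
  ultimately show ?thesis by blast
qed

text \<open>The last clause says that the box \<open>height z < height v\<close>,
  \<open>|L z| < |L u|\<close> holds no nonzero lattice point; later contradictions come from
  exhibiting such a point.\<close>

definition consec :: "int \<times> int \<times> int \<Rightarrow> int \<times> int \<times> int \<Rightarrow> bool" where
  "consec u v \<longleftrightarrow> height u < height v \<and> \<bar>L v\<bar> < \<bar>L u\<bar> \<and> v \<noteq> (0, 0, 0) \<and>
     (\<forall>z. z \<noteq> (0, 0, 0) \<longrightarrow> height z < height v \<longrightarrow> \<bar>L u\<bar> \<le> \<bar>L z\<bar>)"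

lemma consec_minimal:
  assumes "consec u v" "z \<noteq> (0, 0, 0)" "height z < height v"
  shows "\<bar>L u\<bar> \<le> \<bar>L z\<bar>"
  using assms unfolding consec_def by blast

lemma consec_pos:
  assumes "consec u v"
  shows "height v > 0" "\<bar>L u\<bar> > 0" "\<bar>L v\<bar> > 0" "\<bar>L v\<bar> < \<bar>L u\<bar>" "height u < height v"
proof -
  show 1: "\<bar>L v\<bar> < \<bar>L u\<bar>" "height u < height v" using assms unfolding consec_def by blast+
  show "\<bar>L v\<bar> > 0" using L_nonzero[of v] assms unfolding consec_def by simp
  then show "\<bar>L u\<bar> > 0" using 1(1) by linarith
  show "height v > 0" using 1(2) height_nonneg[of u] by linarith
qed

lemma consec_dirichlet:
  assumes "consec u v"
  shows "\<bar>L u\<bar> * of_int (height v) ^ 2 \<le> 2"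
proof (cases "height v = 1")
  case True
  \<comment> \<open>\<open>dirichlet\<close> starts at \<open>N = 2\<close>; for height 1 the vector
    \<open>(1, 0, 0)\<close>, of height 0 and value 1, takes over.\<close>
  then have "\<bar>L u\<bar> \<le> \<bar>L (1, 0, 0)\<bar>" by (intro consec_minimal[OF assms]) auto
  then show ?thesis using True by simp
next
  case False
  define N where "N = nat (height v)"
  have N: "N \<ge> 2" "int N = height v" using False consec_pos(1)[OF assms] by (auto simp: N_def)
  obtain z where z: "z \<noteq> (0, 0, 0)" "height z < int N" "\<bar>L z\<bar> * real N ^ 2 \<le> 2"
    using dirichlet[OF N(1)] by blast
  have "\<bar>L u\<bar> \<le> \<bar>L z\<bar>" using z N(2) by (intro consec_minimal[OF assms]) auto
  then have "\<bar>L u\<bar> * real N ^ 2 \<le> 2"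
    using z(3) mult_right_mono[of "\<bar>L u\<bar>" "\<bar>L z\<bar>" "real N ^ 2"] by simp
  then show ?thesis using N(2) by (metis of_int_of_nat_eq)
qed

text \<open>The two differences are the last coordinates of \<open>l v - l' u\<close>, which spans
  the line where the plane of \<open>u\<close>, \<open>v\<close> meets \<open>L = 0\<close>. If both
  were small, \<open>v\<close> would be close to \<rho> times \<open>u\<close> with
  \<open>\<rho> = l' / l\<close>; comparing \<open>v\<close> with \<open>v - u\<close> or
  \<open>v + u\<close> then forces |\<rho>| below 1/2, and \<open>v\<close> would be too
  short.\<close>

lemma consec_transversal:
  assumes "consec (u0, u1, u2) (v0, v1, v2)"
  defines "l \<equiv> L (u0, u1, u2)" and "l' \<equiv> L (v0, v1, v2)"
  shows "\<bar>l\<bar> * of_int (max \<bar>v1\<bar> \<bar>v2\<bar>) / 2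
    \<le> max \<bar>l * of_int v1 - l' * of_int u1\<bar> \<bar>l * of_int v2 - l' * of_int u2\<bar>"
proof (rule ccontr)
  assume neg: "\<not> ?thesis"
  define Y where "Y = max \<bar>v1\<bar> \<bar>v2\<bar>"
  have c: "Y > 0" "\<bar>l\<bar> > 0" "\<bar>l'\<bar> > 0" "\<bar>l'\<bar> < \<bar>l\<bar>" "\<bar>u1\<bar> < Y" "\<bar>u2\<bar> < Y"
    using consec_pos[OF assms(1)] unfolding l_def l'_def Y_def by auto
  define \<rho> where "\<rho> = l' / l"
  have \<rho>: "\<bar>\<rho>\<bar> < 1" "\<rho> \<noteq> 0" "l' = \<rho> * l" using c by (auto simp: \<rho>_def divide_simps)
  have close: "\<bar>of_int x - \<rho> * of_int y\<bar> < of_int Y / 2"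
    if "\<bar>l * of_int x - l' * of_int y\<bar> < \<bar>l\<bar> * of_int Y / 2" for x y :: int
  proof -
    have "\<bar>l * of_int x - l' * of_int y\<bar> = \<bar>l\<bar> * \<bar>of_int x - \<rho> * of_int y\<bar>"
      unfolding \<rho>(3) by (simp add: algebra_simps flip: abs_mult)
    then show ?thesis using that c(2) by simp
  qed
  have c1: "\<bar>of_int v1 - \<rho> * of_int u1\<bar> < of_int Y / 2" (is "\<bar>?d1\<bar> < _")
    and c2: "\<bar>of_int v2 - \<rho> * of_int u2\<bar> < of_int Y / 2" (is "\<bar>?d2\<bar> < _")
    using neg by (intro close; simp add: Y_def not_le max_def split: if_splits)+
  \<comment> \<open>The sign of \<rho>, so that subtracting \<sigma> times \<open>u\<close> from
    \<open>v\<close> gives a value strictly between 0 and \<open>|l|\<close> in size; minimality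
    then makes that vector high.\<close>
  define \<sigma> :: int where "\<sigma> = (if \<rho> > 0 then 1 else -1)"
  have \<sigma>: "\<bar>\<rho> - of_int \<sigma>\<bar> = 1 - \<bar>\<rho>\<bar>" "\<bar>\<sigma>\<bar> = 1" using \<rho> by (auto simp: \<sigma>_def)
  define z where "z = (v0 - \<sigma> * u0, v1 - \<sigma> * u1, v2 - \<sigma> * u2)"
  have Lz: "L z = (\<rho> - of_int \<sigma>) * l"
    using \<rho>(3) by (simp add: z_def l_def l'_def algebra_simps)
  have "\<rho> - of_int \<sigma> \<noteq> 0" using \<sigma>(1) \<rho>(1) by auto
  then have "L z \<noteq> 0" using Lz c(2) by simp
  then have z0: "z \<noteq> (0, 0, 0)" by auto
  have "\<bar>L z\<bar> = (1 - \<bar>\<rho>\<bar>) * \<bar>l\<bar>" using \<sigma> Lz by (simp add: abs_mult)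
  also have "\<dots> < \<bar>l\<bar>" using \<rho> c by simp
  finally have "\<bar>L z\<bar> < \<bar>l\<bar>" .
  then have "\<not> height z < height (v0, v1, v2)"
    using consec_minimal[OF assms(1) z0] unfolding l_def by linarith
  then have hz: "\<bar>v1 - \<sigma> * u1\<bar> \<ge> Y \<or> \<bar>v2 - \<sigma> * u2\<bar> \<ge> Y" unfolding z_def Y_def height_simp by linarith
  \<comment> \<open>Here \<open>x\<close> and \<open>y\<close> are the same coordinate of
    \<open>v\<close> and \<open>u\<close>, at a place where the height of \<open>z\<close> reaches
    \<open>Y\<close>.\<close>
  have small: "\<bar>\<rho>\<bar> < 1 / 2" if "\<bar>of_int x - \<rho> * of_int y\<bar> < of_int Y / 2" "\<bar>x - \<sigma> * y\<bar> \<ge> Y" "\<bar>y\<bar> < Y"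
    for x y :: int
  proof -
    have "of_int (x - \<sigma> * y) = (of_int x - \<rho> * of_int y) + (\<rho> - of_int \<sigma>) * of_int y"
      by (simp add: algebra_simps)
    moreover have "\<bar>(\<rho> - of_int \<sigma>) * of_int y\<bar> = (1 - \<bar>\<rho>\<bar>) * \<bar>of_int y\<bar>"
      using \<sigma>(1) by (simp add: abs_mult)
    moreover have "(1 - \<bar>\<rho>\<bar>) * \<bar>of_int y\<bar> \<le> (1 - \<bar>\<rho>\<bar>) * of_int Y"
      using that(3) \<rho>(1) by (intro mult_left_mono) linarith+
    moreover have "real_of_int Y \<le> \<bar>of_int (x - \<sigma> * y)\<bar>" using that(2) by linarith
    ultimately have "of_int Y \<le> \<bar>of_int x - \<rho> * of_int y\<bar> + (1 - \<bar>\<rho>\<bar>) * of_int Y" by linarith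
    then have "\<bar>\<rho>\<bar> * of_int Y < 1 / 2 * of_int Y"
      using that(1) by (simp add: left_diff_distrib)
    then show ?thesis using c(1) by (simp only: mult_less_cancel_right_pos of_int_0_less_iff)
  qed
  have "\<bar>\<rho>\<bar> < 1 / 2" using hz small c1 c2 c(5,6) by blast
  have sm: "\<bar>\<rho> * of_int y\<bar> \<le> of_int Y / 2" if "\<bar>y\<bar> < Y" for y :: int
  proof -
    have "\<bar>\<rho>\<bar> * \<bar>of_int y\<bar> \<le> 1 / 2 * of_int Y"
      using \<open>\<bar>\<rho>\<bar> < 1 / 2\<close> that by (intro mult_mono) linarith+
    then show ?thesis by (simp add: abs_mult)
  qed
  have "\<bar>real_of_int v1\<bar> < of_int Y" "\<bar>real_of_int v2\<bar> < of_int Y"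
    using c1 c2 sm[OF c(5)] sm[OF c(6)] by linarith+
  then show False unfolding Y_def by linarith
qed

end

section \<open>Extending two consecutive approximations to a lattice basis\<close>

lemma centered_residue:
  fixes a d :: int
  assumes "d > 0"
  obtains b where "d dvd a - b" "2 * \<bar>b\<bar> \<le> d"
proof -
  define r where "r = a mod d"
  have r: "0 \<le> r" "r < d" using assms by (auto simp: r_def)
  have dvd: "d dvd a - r" by (simp add: r_def)
  have "a - (r - d) = (a - r) + d" by simp
  then have dvd': "d dvd a - (r - d)" using dvd by (metis dvd_add dvd_refl)
  show ?thesis
  proof (cases "2 * r \<le> d")
    case True
    then show ?thesis using r dvd by (intro that[of r]) auto
  next
    case False
    then show ?thesis using r dvd' by (intro that[of "r - d"]) auto
  qed
qed

text \<open>Vanishing minors modulo \<open>d\<close> mean dependence of the rows modulo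
  \<open>d\<close>, also for composite \<open>d\<close>: a column that is nonzero modulo
  \<open>d\<close> supplies the coefficients, which are then reduced to centered residues.\<close>

lemma small_relation_mod:
  fixes d u0 u1 u2 v0 v1 v2 :: int
  assumes d: "d > 1" and "d dvd u0 * v1 - u1 * v0" "d dvd u0 * v2 - u2 * v0" "d dvd u1 * v2 - u2 * v1"
  obtains a b where "(a, b) \<noteq> (0, 0)" "2 * \<bar>a\<bar> \<le> d" "2 * \<bar>b\<bar> \<le> d"
    "d dvd a * u0 + b * v0" "d dvd a * u1 + b * v1" "d dvd a * u2 + b * v2"
proof -
  note goal = that
  \<comment> \<open>\<open>(p, q)\<close> is such a column; the relation is
    \<open>q u - p v = 0\<close> modulo \<open>d\<close>.\<close>
  have *: thesis if "\<not> (d dvd p \<and> d dvd q)"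
    "d dvd p * v0 - u0 * q" "d dvd p * v1 - u1 * q" "d dvd p * v2 - u2 * q" for p q
  proof -
    obtain a where a: "d dvd q - a" "2 * \<bar>a\<bar> \<le> d" using centered_residue[of d q] d by auto
    obtain b where b: "d dvd - p - b" "2 * \<bar>b\<bar> \<le> d" using centered_residue[of d "- p"] d by auto
    have "d dvd a * x + b * y" if "d dvd p * y - x * q" for x y
    proof -
      have "a * x + b * y = - (p * y - x * q) - (q - a) * x - (- p - b) * y"
        by (simp add: algebra_simps)
      moreover have "d dvd - (p * y - x * q)" using that by (simp only: dvd_minus_iff)
      then have "d dvd - (p * y - x * q) - (q - a) * x - (- p - b) * y"
        by (rule dvd_diff[OF dvd_diff[OF _ dvd_mult2[OF a(1)]] dvd_mult2[OF b(1)]])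
      ultimately show ?thesis by simp
    qed
    note comb = this
    have "(a, b) \<noteq> (0, 0)" using a(1) b(1) that(1) by auto
    then show thesis by (rule goal[OF _ a(2) b(2) comb[OF that(2)] comb[OF that(3)] comb[OF that(4)]])
  qed
  consider "\<not> (d dvd u0 \<and> d dvd v0)" | "\<not> (d dvd u1 \<and> d dvd v1)" | "\<not> (d dvd u2 \<and> d dvd v2)"
    | "d dvd u0" "d dvd u1" "d dvd u2" by blast
  then show thesis
  proof cases
    case 1
    then show ?thesis using assms by (intro *[of u0 v0]) auto
  next
    case 2
    have "u1 * v0 - u0 * v1 = - (u0 * v1 - u1 * v0)" by simp
    then have "d dvd u1 * v0 - u0 * v1" using assms(2) by (metis dvd_minus_iff)
    then show ?thesis using assms 2 by (intro *[of u1 v1]) auto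
  next
    case 3
    have "u2 * v0 - u0 * v2 = - (u0 * v2 - u2 * v0)" "u2 * v1 - u1 * v2 = - (u1 * v2 - u2 * v1)" by simp_all
    then have "d dvd u2 * v0 - u0 * v2" "d dvd u2 * v1 - u1 * v2" using assms(3,4) by (metis dvd_minus_iff)+
    then show ?thesis using assms 3 by (intro *[of u2 v2]) auto
  next
    case 4
    \<comment> \<open>Here \<open>u\<close> itself vanishes modulo \<open>d\<close>, and
      \<open>2 <= d\<close> allows the coefficient 1.\<close>
    then show ?thesis using d by (intro that[of 1 0]) auto
  qed
qed

context linear_form
begin

text \<open>A relation between \<open>u\<close> and \<open>v\<close> also holds between
  \<open>l\<close> and \<open>l'\<close>; eliminating shows that \<open>a\<close> and
  \<open>b\<close> annihilate \<open>l v - l' u\<close>, whose last two coordinates do not both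
  vanish by \<open>consec_transversal\<close>.\<close>

lemma consec_independent:
  assumes "consec (u0, u1, u2) (v0, v1, v2)"
    and "a * u0 + b * v0 = 0" "a * u1 + b * v1 = 0" "a * u2 + b * v2 = 0"
  shows "a = 0 \<and> b = 0"
proof -
  define l where "l = L (u0, u1, u2)"
  define l' where "l' = L (v0, v1, v2)"
  have r: "of_int a * of_int u0 + of_int b * of_int v0 = (0 :: real)"
    "of_int a * of_int u1 + of_int b * of_int v1 = (0 :: real)"
    "of_int a * of_int u2 + of_int b * of_int v2 = (0 :: real)"
    using assms(2-4)[THEN arg_cong, of real_of_int] by simp_all
  have "of_int a * l + of_int b * l' =
    (of_int a * of_int u0 + of_int b * of_int v0) + \<alpha> * (of_int a * of_int u1 + of_int b * of_int v1)
     + \<beta> * (of_int a * of_int u2 + of_int b * of_int v2)"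
    by (simp add: l_def l'_def algebra_simps)
  also have "\<dots> = 0" using r by simp
  finally have rl: "of_int a * l + of_int b * l' = 0" .
  have "of_int a * (l * y - l' * x) = 0 \<and> of_int b * (l * y - l' * x) = 0"
    if "of_int a * x + of_int b * y = 0" for x y
  proof -
    have "of_int a * (l * y - l' * x) = (of_int a * l + of_int b * l') * y - l' * (of_int a * x + of_int b * y)"
      "of_int b * (l * y - l' * x) = l * (of_int a * x + of_int b * y) - x * (of_int a * l + of_int b * l')"
      by (simp_all add: algebra_simps)
    then show ?thesis using that rl by simp
  qed
  from this[OF r(2)] this[OF r(3)]
  have 0: "a = 0 \<and> b = 0 \<or> (l * of_int v1 - l' * of_int u1 = 0 \<and> l * of_int v2 - l' * of_int u2 = 0)"
    by auto
  have "0 < \<bar>l\<bar> * of_int (max \<bar>v1\<bar> \<bar>v2\<bar>) / 2"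
    using consec_pos[OF assms(1)] unfolding l_def height_simp by (simp add: mult_pos_pos)
  also note consec_transversal[OF assms(1), folded l_def l'_def]
  finally show ?thesis using 0 by auto
qed

text \<open>Otherwise \<open>(a u + b v) / d\<close> is a nonzero lattice point whose coefficients
  are at most 1/2 in size, so its value and height are at most averages of those of \<open>u\<close>
  and \<open>v\<close>, against minimality.\<close>

lemma consec_primitive:
  assumes c: "consec (u0, u1, u2) (v0, v1, v2)"
    and d: "d dvd u0 * v1 - u1 * v0" "d dvd u0 * v2 - u2 * v0" "d dvd u1 * v2 - u2 * v1"
  shows "\<not> d > 1"
proof
  assume d1: "d > 1"
  obtain a b where ab: "(a, b) \<noteq> (0, 0)" "2 * \<bar>a\<bar> \<le> d" "2 * \<bar>b\<bar> \<le> d"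
    "d dvd a * u0 + b * v0" "d dvd a * u1 + b * v1" "d dvd a * u2 + b * v2"
    using small_relation_mod[OF d1 d] by blast
  then obtain y0 y1 y2 where y: "a * u0 + b * v0 = d * y0" "a * u1 + b * v1 = d * y1" "a * u2 + b * v2 = d * y2"
    unfolding dvd_def by blast
  have y0: "(y0, y1, y2) \<noteq> (0, 0, 0)" using consec_independent[OF c, of a b] ab(1) y by auto
  \<comment> \<open>Stated over the reals so that it serves for the values of \<open>L\<close> as
    well as for the coordinates.\<close>
  have bnd: "2 * \<bar>z\<bar> \<le> \<bar>x\<bar> + \<bar>x'\<bar>" if "of_int a * x + of_int b * x' = of_int d * z" for x x' z :: real
  proof -
    have "2 * (of_int d * \<bar>z\<bar>) = 2 * \<bar>of_int a * x + of_int b * x'\<bar>" using d1 that by (simp add: abs_mult)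
    also have "\<dots> \<le> (2 * \<bar>of_int a\<bar>) * \<bar>x\<bar> + (2 * \<bar>of_int b\<bar>) * \<bar>x'\<bar>"
      using abs_triangle_ineq[of "of_int a * x" "of_int b * x'"] by (simp add: abs_mult)
    also have "\<dots> \<le> of_int d * \<bar>x\<bar> + of_int d * \<bar>x'\<bar>"
      using ab(2,3) by (intro add_mono mult_right_mono) linarith+
    finally have "of_int d * (2 * \<bar>z\<bar>) \<le> of_int d * (\<bar>x\<bar> + \<bar>x'\<bar>)" by (simp add: algebra_simps)
    then show ?thesis using d1 by simp
  qed
  have yr: "of_int a * of_int u0 + of_int b * of_int v0 = of_int d * real_of_int y0"
    "of_int a * of_int u1 + of_int b * of_int v1 = of_int d * real_of_int y1"
    "of_int a * of_int u2 + of_int b * of_int v2 = of_int d * real_of_int y2"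
    using y[THEN arg_cong, of real_of_int] by simp_all
  have "of_int a * L (u0, u1, u2) + of_int b * L (v0, v1, v2) =
    (of_int a * of_int u0 + of_int b * of_int v0) + \<alpha> * (of_int a * of_int u1 + of_int b * of_int v1)
     + \<beta> * (of_int a * of_int u2 + of_int b * of_int v2)"
    by (simp add: algebra_simps)
  also have "\<dots> = of_int d * L (y0, y1, y2)" unfolding yr by (simp add: algebra_simps)
  finally have "2 * \<bar>L (y0, y1, y2)\<bar> \<le> \<bar>L (u0, u1, u2)\<bar> + \<bar>L (v0, v1, v2)\<bar>" by (rule bnd)
  then have "\<bar>L (y0, y1, y2)\<bar> < \<bar>L (u0, u1, u2)\<bar>" using consec_pos(4)[OF c] by linarith
  moreover have "height (y0, y1, y2) < height (v0, v1, v2)"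
  proof -
    have "2 * \<bar>y1\<bar> \<le> \<bar>u1\<bar> + \<bar>v1\<bar>" "2 * \<bar>y2\<bar> \<le> \<bar>u2\<bar> + \<bar>v2\<bar>"
      using bnd[OF yr(2)] bnd[OF yr(3)] by linarith+
    moreover have "\<bar>u1\<bar> < height (v0, v1, v2)" "\<bar>u2\<bar> < height (v0, v1, v2)"
      "\<bar>v1\<bar> \<le> height (v0, v1, v2)" "\<bar>v2\<bar> \<le> height (v0, v1, v2)"
      using consec_pos(5)[OF c] by simp_all
    ultimately show ?thesis unfolding height_simp[of y0] by (simp only: max_less_iff_conj) linarith
  qed
  ultimately show False using consec_minimal[OF c y0] by linarith
qed

text \<open>By primitivity the minors have gcd 1, and Bezout coefficients form the third basis
  vector.\<close>

lemma consec_unimodular: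
  assumes c: "consec (u0, u1, u2) (v0, v1, v2)"
  obtains w0 w1 w2 where
    "w0 * (u1 * v2 - u2 * v1) - w1 * (u0 * v2 - u2 * v0) + w2 * (u0 * v1 - u1 * v0) = 1"
proof -
  define p q r where "p = u1 * v2 - u2 * v1" and "q = u0 * v2 - u2 * v0" and "r = u0 * v1 - u1 * v0"
  define h where "h = gcd (gcd p q) r"
  have "h dvd p" "h dvd q" "h dvd r" unfolding h_def
    by (rule dvd_trans[OF gcd_dvd1 gcd_dvd1] dvd_trans[OF gcd_dvd1 gcd_dvd2] gcd_dvd2)+
  then have "\<not> h > 1" by (intro consec_primitive[OF c]) (simp_all add: p_def q_def r_def)
  \<comment> \<open>If all minors vanished, 2 would divide them.\<close>
  moreover have "h \<noteq> 0"
  proof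
    assume "h = 0"
    then have "p = 0" "q = 0" "r = 0" by (auto simp: h_def)
    then have "\<not> (2 :: int) > 1" by (intro consec_primitive[OF c]) (simp_all add: p_def q_def r_def)
    then show False by simp
  qed
  moreover have "h \<ge> 0" by (simp add: h_def)
  ultimately have "h = 1" by linarith
  obtain a b where ab: "a * p + b * q = gcd p q" using bezout_int by blast
  obtain k w2 where kw: "k * gcd p q + w2 * r = h" unfolding h_def using bezout_int by blast
  have "(k * a) * p - (- k * b) * q + w2 * r = k * (a * p + b * q) + w2 * r"
    by (simp add: algebra_simps)
  also have "\<dots> = 1" unfolding ab kw by fact
  finally show ?thesis unfolding p_def q_def r_def by (rule that)
qed

end

section \<open>Points with positive coordinates\<close>

text \<open>
  The plane through \<open>a w\<close> parallel to \<open>u\<close> and \<open>v\<close> contains a real point \<open>(L, x1, x2) = (0, T1, T2)\<close>, and \<open>16\<close> is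
  large enough for \<open>a = \<plusminus> 16\<close>, \<open>T1 = 2 Y\<close> to give \<open>T2 \<ge> 2 Y\<close>; rounding its coefficients of \<open>u\<close> and \<open>v\<close> moves
  \<open>T1\<close> and \<open>T2\<close> by at most \<open>Y\<close>.
\<close>

lemma round_in_coset:
  fixes u1 u2 v1 v2 w1 w2 Y :: int and l l' m s1 s2 :: real
  defines "s1 \<equiv> l * v1 - l' * u1" and "s2 \<equiv> l * v2 - l' * u2"
  assumes det: "m * (u1 * v2 - u2 * v1) - w1 * s2 + w2 * s1 = 1"
    and Y: "Y > 0" "\<bar>u1\<bar> \<le> Y" "\<bar>u2\<bar> \<le> Y" "\<bar>v1\<bar> \<le> Y" "\<bar>v2\<bar> \<le> Y"
    and l: "\<bar>l'\<bar> \<le> \<bar>l\<bar>" "\<bar>l\<bar> > 0" "\<bar>l\<bar> * Y ^ 2 \<le> 2"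
    and s: "\<bar>s2\<bar> \<le> \<bar>s1\<bar>" "\<bar>l\<bar> * Y / 2 \<le> \<bar>s1\<bar>"
  shows "\<exists>a b c :: int. Y \<le> a * w1 + b * u1 + c * v1 \<and> Y \<le> a * w2 + b * u2 + c * v2
    \<and> a * w1 + b * u1 + c * v1 \<le> 38 / (\<bar>l\<bar> * Y) \<and> a * w2 + b * u2 + c * v2 \<le> 38 / (\<bar>l\<bar> * Y)
    \<and> \<bar>a * m + b * l + c * l'\<bar> \<le> \<bar>l\<bar>"
proof -
  define P where "P = \<bar>l\<bar> * Y"
  have P: "P > 0" unfolding P_def using l(2) Y(1) by (intro mult_pos_pos) simp_all
  have s1: "s1 \<noteq> 0" using s(2) P unfolding P_def by auto
  have PY: "P * Y \<le> 2" using l(3) by (simp add: P_def power2_eq_square mult.assoc)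
  then have Y_le: "Y \<le> 2 / P" using P by (simp add: field_simps)
  have "\<bar>s1\<bar> \<le> \<bar>l * v1\<bar> + \<bar>l' * u1\<bar>" unfolding s1_def by (rule abs_triangle_ineq4)
  also have "\<dots> \<le> \<bar>l\<bar> * Y + \<bar>l\<bar> * Y" unfolding abs_mult
    using Y l by (intro add_mono mult_mono) auto
  finally have s1_le: "\<bar>s1\<bar> \<le> 2 * P" by (simp add: P_def)
  \<comment> \<open>The sign makes \<open>a / s1\<close> equal \<open>16 / |s1|\<close>. Since
    \<open>|s1| <= 2 P\<close> and \<open>Y <= 2 / P\<close>, this is at least \<open>4 Y\<close>,
    which leaves \<open>2 Y\<close> after the perturbation by at most \<open>2 Y\<close>.\<close>
  define a :: int where "a = (if s1 > 0 then 16 else -16)"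
  define T1 :: real where "T1 = 2 * Y"
  define T2 :: real where "T2 = (a + T1 * s2) / s1"
  have as1: "a / s1 = 16 / \<bar>s1\<bar>" using s1 by (auto simp: a_def)
  have T2_alt: "T2 = 16 / \<bar>s1\<bar> + T1 * (s2 / s1)" using as1 by (simp add: T2_def add_divide_distrib)
  have "\<bar>s2 / s1\<bar> \<le> 1" using s(1) s1 by simp
  then have "\<bar>T1 * (s2 / s1)\<bar> \<le> T1 * 1" unfolding abs_mult using Y(1)
    by (intro mult_mono) (auto simp: T1_def)
  then have near: "\<bar>T2 - 16 / \<bar>s1\<bar>\<bar> \<le> 2 * Y" unfolding T2_alt T1_def by simp
  have "16 / \<bar>s1\<bar> \<ge> 16 / (2 * P)" using s1_le s1 P by (intro divide_left_mono) auto
  then have lo: "16 / \<bar>s1\<bar> \<ge> 8 / P" by simp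
  have "16 / \<bar>s1\<bar> \<le> 16 / (P / 2)" using s(2) s1 P unfolding P_def[symmetric]
    by (intro divide_left_mono) auto
  then have hi: "16 / \<bar>s1\<bar> \<le> 32 / P" by simp
  have T2: "T2 \<ge> 2 * Y" "T2 \<le> 36 / P"
    using near lo hi Y_le by (simp_all add: abs_le_iff)
  \<comment> \<open>Cramer's rule for the equations \<open>e0\<close> and \<open>e1\<close>; the
    determinant condition then forces \<open>e2\<close>.\<close>
  define q where "q = (- a * m * v1 - l' * (T1 - a * w1)) / s1"
  define p where "p = (l * (T1 - a * w1) + a * m * u1) / s1"
  have qp: "s1 * q = - a * m * v1 - l' * (T1 - a * w1)" "s1 * p = l * (T1 - a * w1) + a * m * u1"
    using s1 by (simp_all add: q_def p_def)
  have e0: "a * m + q * l + p * l' = 0"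
  proof -
    have "s1 * (a * m + q * l + p * l') = s1 * a * m + (s1 * q) * l + (s1 * p) * l'" by (simp add: algebra_simps)
    also have "\<dots> = 0" unfolding qp by (simp add: s1_def algebra_simps)
    finally show ?thesis using s1 by simp
  qed
  have e1: "a * w1 + q * u1 + p * v1 = T1"
  proof -
    have "s1 * (a * w1 + q * u1 + p * v1) = s1 * a * w1 + (s1 * q) * u1 + (s1 * p) * v1" by (simp add: algebra_simps)
    also have "\<dots> = s1 * T1" unfolding qp by (simp add: s1_def algebra_simps)
    finally show ?thesis using s1 by simp
  qed
  have e2: "a * w2 + q * u2 + p * v2 = T2"
  proof -
    have "s1 * (a * w2 + q * u2 + p * v2) = s1 * a * w2 + (s1 * q) * u2 + (s1 * p) * v2" by (simp add: algebra_simps)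
    also have "\<dots> = a * (m * (u1 * v2 - u2 * v1) - w1 * s2 + w2 * s1) + T1 * s2"
      unfolding qp by (simp add: s2_def algebra_simps)
    also have "\<dots> = s1 * T2" unfolding det T2_def using s1 by simp
    finally show ?thesis using s1 by simp
  qed
  \<comment> \<open>Each coefficient moves by at most 1/2, so any quantity linear in them moves by
    at most a common bound on its two factors: \<open>|l|\<close> for the form, \<open>Y\<close> for
    the coordinates.\<close>
  define b c where "b = round q" and "c = round p"
  have rnd: "\<bar>(a * z + b * x + c * y) - (a * z + q * x + p * y)\<bar> \<le> B"
    if "\<bar>x\<bar> \<le> B" "\<bar>y\<bar> \<le> B" for x y z B :: real
  proof -
    have 1: "\<bar>b - q\<bar> \<le> 1 / 2" "\<bar>c - p\<bar> \<le> 1 / 2"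
      unfolding b_def c_def by (rule of_int_round_abs_le)+
    have "(a * z + b * x + c * y) - (a * z + q * x + p * y) = (b - q) * x + (c - p) * y"
      by (simp add: algebra_simps)
    also have "\<bar>\<dots>\<bar> \<le> \<bar>b - q\<bar> * \<bar>x\<bar> + \<bar>c - p\<bar> * \<bar>y\<bar>"
      using abs_triangle_ineq by (simp add: abs_mult[symmetric])
    also have "\<dots> \<le> 1 / 2 * B + 1 / 2 * B" using 1 that by (intro add_mono mult_mono) auto
    finally show ?thesis by simp
  qed
  have Yr: "\<bar>real_of_int u1\<bar> \<le> Y" "\<bar>real_of_int u2\<bar> \<le> Y" "\<bar>real_of_int v1\<bar> \<le> Y" "\<bar>real_of_int v2\<bar> \<le> Y"
    using Y by linarith+
  have 0: "\<bar>a * m + b * l + c * l'\<bar> \<le> \<bar>l\<bar>"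
    using rnd[of l "\<bar>l\<bar>" l' m] l(1) unfolding e0 by simp
  have "\<bar>(a * w1 + b * u1 + c * v1) - T1\<bar> \<le> real_of_int Y"
    unfolding of_int_add of_int_mult by (rule rnd[OF Yr(1,3), of w1, unfolded e1[unfolded of_int_mult]])
  then have 1: "Y \<le> real_of_int (a * w1 + b * u1 + c * v1)" "a * w1 + b * u1 + c * v1 \<le> 3 * real_of_int Y"
    unfolding T1_def by linarith+
  have "\<bar>(a * w2 + b * u2 + c * v2) - T2\<bar> \<le> real_of_int Y"
    unfolding of_int_add of_int_mult by (rule rnd[OF Yr(2,4), of w2, unfolded e2[unfolded of_int_mult]])
  then have 2: "Y \<le> real_of_int (a * w2 + b * u2 + c * v2)" "a * w2 + b * u2 + c * v2 \<le> 36 / P + real_of_int Y"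
    using T2 by linarith+
  have "2 / P \<ge> 0" using P by simp
  moreover have P38: "38 / P = 19 * (2 / P)" "36 / P = 18 * (2 / P)" by simp_all
  ultimately have "3 * real_of_int Y \<le> 38 / P" "36 / P + real_of_int Y \<le> 38 / P"
    using Y_le unfolding P38 by linarith+
  then show ?thesis using 0 1 2 unfolding P_def of_int_le_iff
    by (intro exI[of _ a] exI[of _ b] exI[of _ c] conjI) linarith+
qed

text \<open>Positivity asks for an integer \<open>a\<close> strictly between
  \<open>3 q1 / p1\<close> and \<open>3 q2 / p2\<close> (no upper limit if \<open>p2 = 0\<close>);
  assumption \<open>D\<close> makes this gap longer than 1, and the least integer above the lower
  end keeps the sizes under control.\<close>

lemma transversal_combination:
  fixes p1 p2 q1 q2 :: int
  assumes nn: "p1 \<ge> 0" "p2 \<ge> 0" "q1 \<ge> 0" "q2 \<ge> 0"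
    and D: "3 * (p1 * q2 - p2 * q1) > max p1 p2 ^ 2"
  shows "\<exists>a. 0 < a * p1 - 3 * q1 \<and> 0 < 3 * q2 - a * p2 \<and> a * p1 - 3 * q1 \<le> max p1 p2
    \<and> 3 * q2 - a * p2 \<le> 3 * max q1 q2 \<and> 0 \<le> a \<and> a * max p1 p2 \<le> 3 * max q1 q2 + max p1 p2"
proof -
  have "p1 * p2 \<le> max p1 p2 * max p1 p2" using nn by (intro mult_mono) auto
  then have D1: "p1 * p2 + 3 * p2 * q1 < 3 * (p1 * q2)" using D by (simp add: power2_eq_square)
  have p1: "p1 > 0"
  proof (rule ccontr)
    assume "\<not> p1 > 0"
    then have "p1 = 0" using nn by simp
    moreover have "p2 * q1 \<ge> 0" using nn by simp
    ultimately show False using D1 by simp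
  qed
  define a where "a = 3 * q1 div p1 + 1"
  have "3 * q1 = p1 * (3 * q1 div p1) + 3 * q1 mod p1" by simp
  moreover have "0 \<le> 3 * q1 mod p1" "3 * q1 mod p1 < p1" using p1 by simp_all
  moreover have "a * p1 = p1 * (3 * q1 div p1) + p1" by (simp add: a_def algebra_simps)
  ultimately have a1: "3 * q1 < a * p1" "a * p1 \<le> 3 * q1 + p1" by linarith+
  have a0: "a \<ge> 0" using p1 nn by (simp add: a_def pos_imp_zdiv_nonneg_iff)
  have "p1 * (a * p2) = (a * p1) * p2" by simp
  also have "\<dots> \<le> (3 * q1 + p1) * p2" using a1 nn by (intro mult_right_mono) auto
  also have "\<dots> < p1 * (3 * q2)" using D1 by (simp add: algebra_simps)
  finally have a2: "a * p2 < 3 * q2" using p1 by simp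
  have "a * p2 \<ge> 0" using a0 nn by simp
  have "a * max p1 p2 \<le> 3 * max q1 q2 + max p1 p2"
    using a1 a2 nn by (cases "p1 \<le> p2") (simp_all add: max_def)
  then show ?thesis using a0 a1 a2 \<open>a * p2 \<ge> 0\<close> by (intro exI[of _ a]) auto
qed

lemma opposite_signs:
  fixes x y :: int
  assumes "x * y \<le> 0"
  obtains s where "\<bar>s\<bar> = 1" "s * x = \<bar>x\<bar>" "s * y = - \<bar>y\<bar>"
proof (cases "x > 0 \<or> (x = 0 \<and> y \<le> 0)")
  case True
  then have "y \<le> 0" using assms by (auto simp: mult_le_0_iff)
  then show ?thesis using True by (intro that[of 1]) auto
next
  case False
  then have "y \<ge> 0" "x \<le> 0" using assms by (auto simp: mult_le_0_iff)
  then show ?thesis using False by (intro that[of "-1"]) auto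
qed

context linear_form
begin

text \<open>After sign changes both vectors have the form (nonnegative, nonpositive), so a
  difference of multiples can be made positive in both coordinates. Its value is at most
  \<open>(a + 3) |L u|\<close>, and \<open>(a + 3) X <= 3 Y + 4 X <= 7 Y\<close>.\<close>

lemma positive_combination:
  fixes u0 u1 u2 v0 v1 v2 X Y :: int
  assumes c: "consec (u0, u1, u2) (v0, v1, v2)"
    and opp: "u1 * u2 \<le> 0" "v1 * v2 \<le> 0"
    and D: "3 * \<bar>u1 * v2 - u2 * v1\<bar> > max \<bar>u1\<bar> \<bar>u2\<bar> ^ 2"
  defines "X \<equiv> max \<bar>u1\<bar> \<bar>u2\<bar>" and "Y \<equiv> max \<bar>v1\<bar> \<bar>v2\<bar>"
  shows "\<exists>x0 x1 x2. 0 < x1 \<and> 0 < x2 \<and> x1 \<le> 3 * Y \<and> x2 \<le> 3 * Y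
    \<and> \<bar>L (x0, x1, x2)\<bar> * X \<le> 7 * Y * \<bar>L (u0, u1, u2)\<bar>"
proof -
  obtain s where s: "\<bar>s\<bar> = 1" "s * u1 = \<bar>u1\<bar>" "s * u2 = - \<bar>u2\<bar>" by (rule opposite_signs[OF opp(1)])
  obtain t where t: "\<bar>t\<bar> = 1" "t * v1 = \<bar>v1\<bar>" "t * v2 = - \<bar>v2\<bar>" by (rule opposite_signs[OF opp(2)])
  have XY: "X < Y" "X \<ge> 0" using consec_pos(5)[OF c] by (simp_all add: X_def Y_def le_max_iff_disj)
  have "\<bar>u1 * v2 - u2 * v1\<bar> = \<bar>s * t\<bar> * \<bar>u1 * v2 - u2 * v1\<bar>" using s t by (simp add: abs_mult)
  also have "\<dots> = \<bar>(s * u1) * (t * v2) - (s * u2) * (t * v1)\<bar>"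
    by (simp add: algebra_simps flip: abs_mult)
  also have "\<dots> = \<bar>\<bar>u1\<bar> * \<bar>v2\<bar> - \<bar>u2\<bar> * \<bar>v1\<bar>\<bar>" unfolding s t by (simp add: abs_minus_commute)
  finally have D': "3 * \<bar>\<bar>u1\<bar> * \<bar>v2\<bar> - \<bar>u2\<bar> * \<bar>v1\<bar>\<bar> > X ^ 2" using D by (simp add: X_def)
  \<comment> \<open>The sign \<open>e\<close> allows the combination to be negated, as the second
    orientation requires.\<close>
  have bound: "\<bar>of_int e * (of_int a * of_int s * L (u0, u1, u2) - 3 * of_int t * L (v0, v1, v2))\<bar> * X
      \<le> 7 * Y * \<bar>L (u0, u1, u2)\<bar>"
    if "a \<ge> 0" "a * X \<le> 3 * Y + X" "\<bar>e\<bar> = 1" for a e :: int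
  proof -
    let ?l = "\<bar>L (u0, u1, u2)\<bar>"
    have st: "\<bar>real_of_int s\<bar> = 1" "\<bar>real_of_int t\<bar> = 1" "\<bar>real_of_int e\<bar> = 1"
      using s(1) t(1) that(3) by linarith+
    have "\<bar>of_int e * (of_int a * of_int s * L (u0, u1, u2) - 3 * of_int t * L (v0, v1, v2))\<bar>
      \<le> \<bar>of_int a * of_int s * L (u0, u1, u2)\<bar> + \<bar>3 * of_int t * L (v0, v1, v2)\<bar>"
      unfolding abs_mult[of "of_int e"] st mult_1 by (rule abs_triangle_ineq4)
    also have "\<dots> = of_int a * ?l + 3 * \<bar>L (v0, v1, v2)\<bar>" using that(1) st by (simp only: abs_mult)
    also have "\<dots> \<le> of_int a * ?l + 3 * ?l" using consec_pos(4)[OF c] by linarith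
    finally have "\<bar>of_int e * (of_int a * of_int s * L (u0, u1, u2) - 3 * of_int t * L (v0, v1, v2))\<bar> * X
      \<le> (of_int a * ?l + 3 * ?l) * X" using XY by (intro mult_right_mono) auto
    also have "\<dots> = real_of_int (a * X + 3 * X) * ?l" by (simp only: of_int_add of_int_mult algebra_simps of_int_numeral)
    also have "\<dots> \<le> real_of_int (7 * Y) * ?l"
    proof (rule mult_right_mono[OF _ abs_ge_zero])
      have "a * X + 3 * X \<le> 7 * Y" using that(2) XY by linarith
      then show "real_of_int (a * X + 3 * X) \<le> real_of_int (7 * Y)" by (simp only: of_int_le_iff)
    qed
    finally show ?thesis by simp
  qed
  have L_comb: "L (e * (a * s * u0 - 3 * t * v0), e * (a * s * u1 - 3 * t * v1), e * (a * s * u2 - 3 * t * v2))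
    = of_int e * (of_int a * of_int s * L (u0, u1, u2) - 3 * of_int t * L (v0, v1, v2))" for a e
    by (simp add: algebra_simps)
  have sgn: "a * s * u1 - 3 * t * v1 = a * \<bar>u1\<bar> - 3 * \<bar>v1\<bar>" "a * s * u2 - 3 * t * v2 = 3 * \<bar>v2\<bar> - a * \<bar>u2\<bar>" for a
    by (simp_all only: mult.assoc s t)
  show ?thesis
  proof (cases "\<bar>u1\<bar> * \<bar>v2\<bar> - \<bar>u2\<bar> * \<bar>v1\<bar> > 0")
    case True
    then have "3 * (\<bar>u1\<bar> * \<bar>v2\<bar> - \<bar>u2\<bar> * \<bar>v1\<bar>) > max \<bar>u1\<bar> \<bar>u2\<bar> ^ 2"
      using D' unfolding X_def by (simp only: abs_of_pos)
    from transversal_combination[OF abs_ge_zero abs_ge_zero abs_ge_zero abs_ge_zero this]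
    obtain a where a: "0 < a * \<bar>u1\<bar> - 3 * \<bar>v1\<bar>" "0 < 3 * \<bar>v2\<bar> - a * \<bar>u2\<bar>"
      "a * \<bar>u1\<bar> - 3 * \<bar>v1\<bar> \<le> X" "3 * \<bar>v2\<bar> - a * \<bar>u2\<bar> \<le> 3 * Y" "0 \<le> a" "a * X \<le> 3 * Y + X"
      unfolding X_def Y_def by blast
    have "\<bar>L (a * s * u0 - 3 * t * v0, a * \<bar>u1\<bar> - 3 * \<bar>v1\<bar>, 3 * \<bar>v2\<bar> - a * \<bar>u2\<bar>)\<bar> * X
      \<le> 7 * Y * \<bar>L (u0, u1, u2)\<bar>"
      using bound[OF a(5,6), of 1] L_comb[of 1 a] by (simp only: mult_1 sgn abs_one of_int_1)
    moreover have "a * \<bar>u1\<bar> - 3 * \<bar>v1\<bar> \<le> 3 * Y" using a(3) XY by linarith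
    ultimately show ?thesis using a(1,2,4) by blast
  next
    case False
    \<comment> \<open>The opposite orientation: exchange the two coordinates and negate the
      combination.\<close>
    then have "\<bar>\<bar>u1\<bar> * \<bar>v2\<bar> - \<bar>u2\<bar> * \<bar>v1\<bar>\<bar> = \<bar>u2\<bar> * \<bar>v1\<bar> - \<bar>u1\<bar> * \<bar>v2\<bar>" by linarith
    then have "3 * (\<bar>u2\<bar> * \<bar>v1\<bar> - \<bar>u1\<bar> * \<bar>v2\<bar>) > max \<bar>u2\<bar> \<bar>u1\<bar> ^ 2"
      using D' unfolding X_def by (simp only: max.commute)
    from transversal_combination[OF abs_ge_zero abs_ge_zero abs_ge_zero abs_ge_zero this]
    obtain a where a: "0 < a * \<bar>u2\<bar> - 3 * \<bar>v2\<bar>" "0 < 3 * \<bar>v1\<bar> - a * \<bar>u1\<bar>"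
      "a * \<bar>u2\<bar> - 3 * \<bar>v2\<bar> \<le> X" "3 * \<bar>v1\<bar> - a * \<bar>u1\<bar> \<le> 3 * Y" "0 \<le> a" "a * X \<le> 3 * Y + X"
      unfolding X_def Y_def max.commute[of "\<bar>u2\<bar>"] max.commute[of "\<bar>v2\<bar>"] by blast
    have neg: "-1 * (a * \<bar>u1\<bar> - 3 * \<bar>v1\<bar>) = 3 * \<bar>v1\<bar> - a * \<bar>u1\<bar>"
      "-1 * (3 * \<bar>v2\<bar> - a * \<bar>u2\<bar>) = a * \<bar>u2\<bar> - 3 * \<bar>v2\<bar>" by simp_all
    have "\<bar>L (-1 * (a * s * u0 - 3 * t * v0), 3 * \<bar>v1\<bar> - a * \<bar>u1\<bar>, a * \<bar>u2\<bar> - 3 * \<bar>v2\<bar>)\<bar> * X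
      \<le> 7 * Y * \<bar>L (u0, u1, u2)\<bar>"
      using bound[OF a(5,6), of "-1"] L_comb[of "-1" a] by (simp only: sgn neg)
    moreover have "a * \<bar>u2\<bar> - 3 * \<bar>v2\<bar> \<le> 3 * Y" using a(3) XY by linarith
    ultimately show ?thesis using a(1,2,4) by blast
  qed
qed

text \<open>The basis vector \<open>w\<close> from \<open>consec_unimodular\<close> feeds
  \<open>round_in_coset\<close>, with the larger of the two differences in the role of the pivot
  \<open>s1\<close>.\<close>

lemma coset_point:
  fixes u0 u1 u2 v0 v1 v2 Y :: int and l :: real
  assumes c: "consec (u0, u1, u2) (v0, v1, v2)"
  defines "Y \<equiv> max \<bar>v1\<bar> \<bar>v2\<bar>" and "l \<equiv> \<bar>L (u0, u1, u2)\<bar>"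
  shows "\<exists>x0 x1 x2. Y \<le> x1 \<and> Y \<le> x2 \<and> x1 \<le> 38 / (l * Y) \<and> x2 \<le> 38 / (l * Y)
    \<and> \<bar>L (x0, x1, x2)\<bar> \<le> l"
proof -
  obtain w0 w1 w2 where w: "w0 * (u1 * v2 - u2 * v1) - w1 * (u0 * v2 - u2 * v0) + w2 * (u0 * v1 - u1 * v0) = 1"
    using consec_unimodular[OF c] .
  define lu lv m where "lu = L (u0, u1, u2)" and "lv = L (v0, v1, v2)" and "m = L (w0, w1, w2)"
  let ?s1 = "lu * of_int v1 - lv * of_int u1" and ?s2 = "lu * of_int v2 - lv * of_int u2"
  \<comment> \<open>Replacing first coordinates by values of \<open>L\<close> adds multiples of the
    other coordinates, which preserves the determinant.\<close>
  have "m * of_int (u1 * v2 - u2 * v1) - of_int w1 * ?s2 + of_int w2 * ?s1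
    = real_of_int (w0 * (u1 * v2 - u2 * v1) - w1 * (u0 * v2 - u2 * v0) + w2 * (u0 * v1 - u1 * v0))"
    by (simp add: lu_def lv_def m_def algebra_simps)
  then have det: "m * of_int (u1 * v2 - u2 * v1) - of_int w1 * ?s2 + of_int w2 * ?s1 = 1"
    unfolding w by simp
  have Y: "Y > 0" "\<bar>u1\<bar> \<le> Y" "\<bar>u2\<bar> \<le> Y" "\<bar>v1\<bar> \<le> Y" "\<bar>v2\<bar> \<le> Y"
    using consec_pos(1,5)[OF c] by (auto simp: Y_def)
  have l: "\<bar>lv\<bar> \<le> \<bar>lu\<bar>" "\<bar>lu\<bar> > 0" "\<bar>lu\<bar> * of_int (Y ^ 2) \<le> 2"
    using consec_pos(2,4)[OF c] consec_dirichlet[OF c] unfolding lu_def lv_def Y_def by simp_all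
  have s: "\<bar>lu\<bar> * of_int Y / 2 \<le> max \<bar>?s1\<bar> \<bar>?s2\<bar>"
    using consec_transversal[OF c] unfolding lu_def lv_def Y_def .
  have comb: "of_int a * m + of_int b * lu + of_int c * lv
    = L (a * w0 + b * u0 + c * v0, a * w1 + b * u1 + c * v1, a * w2 + b * u2 + c * v2)" for a b c
    by (simp add: lu_def lv_def m_def algebra_simps)
  show ?thesis
  proof (cases "\<bar>?s2\<bar> \<le> \<bar>?s1\<bar>")
    case True
    then have "\<bar>lu\<bar> * of_int Y / 2 \<le> \<bar>?s1\<bar>" using s by simp
    from round_in_coset[OF det Y l True this] show ?thesis
      unfolding comb l_def lu_def[symmetric] by blast
  next
    case False
    then have s': "\<bar>?s1\<bar> \<le> \<bar>?s2\<bar>" "\<bar>lu\<bar> * of_int Y / 2 \<le> \<bar>?s2\<bar>" using s by simp_all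
    \<comment> \<open>Exchanging the coordinates reverses the determinant, and negating
      \<open>w\<close> restores it.\<close>
    have det': "- m * of_int (u2 * v1 - u1 * v2) - of_int (- w2) * ?s1 + of_int (- w1) * ?s2 = 1"
      using det by (simp add: algebra_simps)
    obtain a b c where abc: "Y \<le> a * - w2 + b * u2 + c * v2" "Y \<le> a * - w1 + b * u1 + c * v1"
      "of_int (a * - w2 + b * u2 + c * v2) \<le> 38 / (\<bar>lu\<bar> * of_int Y)"
      "of_int (a * - w1 + b * u1 + c * v1) \<le> 38 / (\<bar>lu\<bar> * of_int Y)"
      "\<bar>of_int a * - m + of_int b * lu + of_int c * lv\<bar> \<le> \<bar>lu\<bar>"
      using round_in_coset[OF det' Y(1,3,2,5,4) l s'] by blast
    have "of_int a * - m = of_int (- a) * m" "a * - w0 = - a * w0" "a * - w1 = - a * w1" "a * - w2 = - a * w2"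
      by simp_all
    then show ?thesis using abc unfolding l_def lu_def[symmetric] by (metis comb)
  qed
qed

end

section \<open>Independent triples\<close>

definition det :: "int \<times> int \<times> int \<Rightarrow> int \<times> int \<times> int \<Rightarrow> int \<times> int \<times> int \<Rightarrow> int" where
  "det = (\<lambda>(t0, t1, t2) (u0, u1, u2) (v0, v1, v2).
    t0 * (u1 * v2 - u2 * v1) - u0 * (t1 * v2 - t2 * v1) + v0 * (t1 * u2 - t2 * u1))"

lemma det_simp [simp]:
  "det (t0, t1, t2) (u0, u1, u2) (v0, v1, v2) =
    t0 * (u1 * v2 - u2 * v1) - u0 * (t1 * v2 - t2 * v1) + v0 * (t1 * u2 - t2 * u1)"
  by (simp add: det_def)

definition cross :: "int \<times> int \<times> int \<Rightarrow> int \<times> int \<times> int \<Rightarrow> int" where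
  "cross = (\<lambda>(u0, u1, u2) (v0, v1, v2). u1 * v2 - u2 * v1)"

lemma cross_simp [simp]: "cross (u0, u1, u2) (v0, v1, v2) = u1 * v2 - u2 * v1"
  by (simp add: cross_def)

lemma abs_cross_le: "\<bar>cross u v\<bar> \<le> 2 * height u * height v"
proof -
  obtain u0 u1 u2 v0 v1 v2 where uv: "u = (u0, u1, u2)" "v = (v0, v1, v2)"
    by (metis prod_cases3)
  have "\<bar>u1\<bar> * \<bar>v2\<bar> \<le> height u * height v" "\<bar>u2\<bar> * \<bar>v1\<bar> \<le> height u * height v"
    unfolding uv height_simp by (intro mult_mono; simp)+
  moreover have "\<bar>cross u v\<bar> \<le> \<bar>u1\<bar> * \<bar>v2\<bar> + \<bar>u2\<bar> * \<bar>v1\<bar>"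
    unfolding uv cross_simp by (rule order_trans[OF abs_triangle_ineq4]) (simp add: abs_mult)
  ultimately show ?thesis by linarith
qed

context linear_form
begin

text \<open>Adding \<alpha> and \<beta> times the other coordinates to the first does not change a
  determinant.\<close>

lemma det_eq:
  "real_of_int (det t u v) = L t * cross u v - L u * cross t v + L v * cross t u"
  by (cases t rule: prod_cases3; cases u rule: prod_cases3; cases v rule: prod_cases3)
     (simp add: algebra_simps)

text \<open>If \<open>t\<close>, \<open>u\<close>, \<open>v\<close> are independent, the term \<open>L t * cross u v\<close> dominates the determinant.\<close>

lemma cross_large:
  assumes tu: "consec t u" and uv: "consec u v" and det: "det t u v \<noteq> 0"
    and small: "\<bar>L u\<bar> * of_int (height v) ^ 2 \<le> 1 / 64"
  shows "3 * \<bar>cross u v\<bar> > height u ^ 2"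
proof -
  define X where "X = real_of_int (height u)"
  define Y where "Y = real_of_int (height v)"
  note pos = consec_pos[OF tu] consec_pos[OF uv]
  have X: "X > 0" "X \<le> Y" "real_of_int (height t) \<le> Y" "0 \<le> real_of_int (height t)"
    using pos height_nonneg[of t] unfolding X_def Y_def by simp_all
  \<comment> \<open>Each of the two remaining terms is at most \<open>|L u| * 2 Y^2\<close>, hence
    at most \<open>2 / 64\<close>.\<close>
  have bd: "\<bar>L z\<bar> * real_of_int \<bar>cross t w\<bar> \<le> 1 / 32"
    if z: "\<bar>L z\<bar> \<le> \<bar>L u\<bar>" and w: "0 \<le> height w" "real_of_int (height w) \<le> Y" for z w
  proof -
    have "real_of_int \<bar>cross t w\<bar> \<le> real_of_int (2 * height t * height w)"
      using abs_cross_le[of t w] by (simp only: of_int_le_iff)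
    also have "\<dots> = 2 * (real_of_int (height t) * real_of_int (height w))" by simp
    also have "\<dots> \<le> 2 * (Y * Y)" using X w by (intro mult_left_mono mult_mono) auto
    finally have "\<bar>L z\<bar> * real_of_int \<bar>cross t w\<bar> \<le> \<bar>L u\<bar> * (2 * (Y * Y))"
      using z by (intro mult_mono) auto
    also have "\<dots> \<le> 1 / 32" using small by (simp add: Y_def power2_eq_square)
    finally show ?thesis .
  qed
  have "1 \<le> \<bar>det t u v\<bar>" using det by linarith
  then have "1 \<le> \<bar>real_of_int (det t u v)\<bar>" by linarith
  also have "\<dots> \<le> \<bar>L t * cross u v\<bar> + \<bar>L u * cross t v\<bar> + \<bar>L v * cross t u\<bar>"
    unfolding det_eq by linarith
  also have "\<dots> = \<bar>L t\<bar> * real_of_int \<bar>cross u v\<bar> + \<bar>L u\<bar> * real_of_int \<bar>cross t v\<bar> + \<bar>L v\<bar> * real_of_int \<bar>cross t u\<bar>"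
    by (simp add: abs_mult)
  also have "\<dots> \<le> \<bar>L t\<bar> * real_of_int \<bar>cross u v\<bar> + 1 / 32 + 1 / 32"
    using pos X(2) by (intro add_mono order_refl bd) (simp_all add: X_def Y_def height_nonneg)
  finally have "15 / 16 \<le> \<bar>L t\<bar> * real_of_int \<bar>cross u v\<bar>" by simp
  \<comment> \<open>\<open>|L t| X^2 <= 2\<close> now turns this into
    \<open>X^2 <= 32/15 * |cross u v|\<close>, and \<open>32/15 < 3\<close>.\<close>
  then have "15 / 16 * X ^ 2 \<le> (\<bar>L t\<bar> * real_of_int \<bar>cross u v\<bar>) * X ^ 2" by (intro mult_right_mono) auto
  also have "\<dots> = (\<bar>L t\<bar> * X ^ 2) * real_of_int \<bar>cross u v\<bar>" by simp
  also have "\<dots> \<le> 2 * real_of_int \<bar>cross u v\<bar>"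
    using consec_dirichlet[OF tu] by (intro mult_right_mono) (simp_all add: X_def)
  finally have "15 / 16 * X ^ 2 \<le> 2 * real_of_int \<bar>cross u v\<bar>" .
  moreover have "X ^ 2 > 0" using X by simp
  ultimately have "X ^ 2 < 3 * real_of_int \<bar>cross u v\<bar>" by linarith
  then have "real_of_int (height u ^ 2) < real_of_int (3 * \<bar>cross u v\<bar>)" by (simp add: X_def)
  then show ?thesis by (simp only: of_int_less_iff)
qed

section \<open>An infinite sequence of best approximations\<close>

text \<open>Competitors of equal height are included, so that any nonzero point of smaller value is
  strictly higher.\<close>

definition best :: "int \<times> int \<times> int \<Rightarrow> bool" where
  "best v \<longleftrightarrow> v \<noteq> (0, 0, 0) \<and> (\<forall>z. z \<noteq> (0, 0, 0) \<longrightarrow> height z \<le> height v \<longrightarrow> \<bar>L v\<bar> \<le> \<bar>L z\<bar>)"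

lemma best_initial: "best (1, 0, 0)"
  unfolding best_def by (auto simp: le_max_iff_disj simp flip: of_int_abs)

lemma finite_bounded: "finite {z. height z \<le> h \<and> \<bar>L z\<bar> \<le> B}"
proof (rule finite_subset)
  define K where "K = \<lceil>B + \<bar>\<alpha>\<bar> * of_int h + \<bar>\<beta>\<bar> * of_int h\<rceil>"
  show "finite ({-K..K} \<times> {-h..h} \<times> {-h..h})" by simp
  show "{z. height z \<le> h \<and> \<bar>L z\<bar> \<le> B} \<subseteq> {-K..K} \<times> {-h..h} \<times> {-h..h}"
  proof safe
    fix a b c
    assume z: "height (a, b, c) \<le> h" "\<bar>L (a, b, c)\<bar> \<le> B"
    then have bc: "\<bar>b\<bar> \<le> h" "\<bar>c\<bar> \<le> h" by simp_all
    then have "\<bar>\<alpha> * of_int b\<bar> \<le> \<bar>\<alpha>\<bar> * of_int h" "\<bar>\<beta> * of_int c\<bar> \<le> \<bar>\<beta>\<bar> * of_int h"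
      unfolding abs_mult by (intro mult_left_mono; linarith)+
    moreover have "\<bar>of_int a + \<alpha> * of_int b + \<beta> * of_int c\<bar> \<le> B" using z(2) by simp
    ultimately have "\<bar>real_of_int a\<bar> \<le> B + \<bar>\<alpha>\<bar> * of_int h + \<bar>\<beta>\<bar> * of_int h" by linarith
    then have "\<bar>a\<bar> \<le> K" unfolding K_def by linarith
    then show "a \<in> {-K..K}" by auto
    show "b \<in> {-h..h}" "c \<in> {-h..h}" using bc by auto
  qed
qed

text \<open>Among the points that beat \<open>v\<close>, take the least height first and then, by
  finiteness, the least value at that height.\<close>

lemma best_successor:
  assumes "best v"
  shows "\<exists>v'. best v' \<and> consec v v'"
proof -
  define S where "S = {z. z \<noteq> (0, 0, 0) \<and> \<bar>L z\<bar> < \<bar>L v\<bar>}"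
  have Lv: "\<bar>L v\<bar> > 0" using assms L_nonzero[of v] unfolding best_def by simp
  \<comment> \<open>With \<open>2 / N < |L v|\<close>, Dirichlet's theorem yields a point that beats
    \<open>v\<close>.\<close>
  define N where "N = nat \<lceil>2 / \<bar>L v\<bar>\<rceil> + 2"
  have "N \<ge> 2" by (simp add: N_def)
  have "real N > 2 / \<bar>L v\<bar>" unfolding N_def by linarith
  then have N: "2 < real N * \<bar>L v\<bar>" using Lv by (simp add: field_simps)
  obtain z where z: "z \<noteq> (0, 0, 0)" "\<bar>L z\<bar> * real N ^ 2 \<le> 2"
    using dirichlet[OF \<open>N \<ge> 2\<close>] by blast
  have "\<bar>L z\<bar> * real N \<le> \<bar>L z\<bar> * real N ^ 2"
    using \<open>N \<ge> 2\<close> by (intro mult_left_mono) (simp_all add: self_le_power)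
  then have "\<bar>L z\<bar> * real N < \<bar>L v\<bar> * real N" using z(2) N by (simp add: mult.commute)
  then have "z \<in> S" using z(1) by (simp add: S_def mult_less_cancel_right)
  then obtain y where y: "y \<in> S" "\<And>x. x \<in> S \<Longrightarrow> nat (height y) \<le> nat (height x)"
    using ex_has_least_nat[of "\<lambda>x. x \<in> S" z "\<lambda>x. nat (height x)"] by blast
  then have y_min: "height y \<le> height x" if "x \<in> S" for x
    using height_nonneg[of x] height_nonneg[of y] that by (metis nat_le_eq_zle order_antisym_conv nat_mono)
  define S' where "S' = {x \<in> S. height x = height y}"
  have "finite S'" by (rule finite_subset[OF _ finite_bounded[of "height y" "\<bar>L v\<bar>"]]) (auto simp: S'_def S_def)
  then obtain v' where v': "v' \<in> S'" "\<And>x. x \<in> S' \<Longrightarrow> \<bar>L v'\<bar> \<le> \<bar>L x\<bar>"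
    using ex_is_arg_min_if_finite[of S' "\<lambda>x. \<bar>L x\<bar>"] y(1)
    unfolding is_arg_min_linorder S'_def by blast
  have v'S: "v' \<in> S" "height v' = height y" using v'(1) by (simp_all add: S'_def)
  have "best v'" unfolding best_def
  proof (intro conjI allI impI)
    show "v' \<noteq> (0, 0, 0)" using v'S by (simp add: S_def)
    fix x assume x: "x \<noteq> (0, 0, 0)" "height x \<le> height v'"
    show "\<bar>L v'\<bar> \<le> \<bar>L x\<bar>"
    proof (cases "x \<in> S")
      case True
      then have "x \<in> S'" using x y_min[OF True] v'S by (simp add: S'_def)
      then show ?thesis by (rule v'(2))
    next
      case False
      then have "\<bar>L v\<bar> \<le> \<bar>L x\<bar>" using x(1) by (simp add: S_def)
      then show ?thesis using v'S(1) by (simp add: S_def)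
    qed
  qed
  moreover have "consec v v'" unfolding consec_def
  proof (intro conjI allI impI)
    show l: "\<bar>L v'\<bar> < \<bar>L v\<bar>" and n: "v' \<noteq> (0, 0, 0)" using v'S by (simp_all add: S_def)
    show "height v < height v'"
    proof (rule ccontr)
      assume "\<not> height v < height v'"
      then have "\<bar>L v\<bar> \<le> \<bar>L v'\<bar>" using assms n unfolding best_def not_less by blast
      then show False using l by simp
    qed
    fix x assume x: "x \<noteq> (0, 0, 0)" "height x < height v'"
    then have "x \<notin> S" using y_min[of x] v'S(2) by auto
    then show "\<bar>L v\<bar> \<le> \<bar>L x\<bar>" using x(1) by (simp add: S_def)
  qed
  ultimately show ?thesis by blast
qed

lemma best_sequence: "\<exists>f. \<forall>n. consec (f n) (f (Suc n))"
proof -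
  have "\<exists>f. \<forall>n. best (f n) \<and> consec (f n) (f (Suc n))"
    using best_initial best_successor by (intro dependent_nat_choice) auto
  then show ?thesis by blast
qed

section \<open>Dependent triples cannot persist\<close>

text \<open>The coordinate \<open>p\<close> of the vector \<open>L u * v - L v * u\<close> in the
  kernel of \<open>L\<close>; \<open>p\<close> is meant to be one of the last two
  projections.\<close>

definition shear :: "(int \<times> int \<times> int \<Rightarrow> int) \<Rightarrow> int \<times> int \<times> int \<Rightarrow> int \<times> int \<times> int \<Rightarrow> real" where
  "shear p u v = L u * of_int (p v) - L v * of_int (p u)"

lemma shear_bound:
  assumes c: "consec u v" and p: "\<And>z. \<bar>p z\<bar> \<le> height z"
  shows "\<bar>shear p u v\<bar> * of_int (height v) \<le> 4"
proof -
  let ?Y = "real_of_int (height v)"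
  have Y: "?Y > 0" using consec_pos[OF c] by simp
  have "\<bar>p v\<bar> \<le> height v" "\<bar>p u\<bar> \<le> height v" using p[of u] p[of v] consec_pos(5)[OF c] by linarith+
  then have pp: "\<bar>real_of_int (p v)\<bar> \<le> ?Y" "\<bar>real_of_int (p u)\<bar> \<le> ?Y" by linarith+
  have "\<bar>shear p u v\<bar> \<le> \<bar>L u\<bar> * \<bar>of_int (p v)\<bar> + \<bar>L v\<bar> * \<bar>of_int (p u)\<bar>"
    unfolding shear_def by (rule order_trans[OF abs_triangle_ineq4]) (simp add: abs_mult)
  also have "\<dots> \<le> \<bar>L u\<bar> * ?Y + \<bar>L u\<bar> * ?Y"
    using pp consec_pos(4)[OF c] by (intro add_mono mult_mono) simp_all
  finally have "\<bar>shear p u v\<bar> * ?Y \<le> (\<bar>L u\<bar> * ?Y + \<bar>L u\<bar> * ?Y) * ?Y" using Y by (intro mult_right_mono) simp_all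
  also have "\<dots> = 2 * (\<bar>L u\<bar> * ?Y ^ 2)" by (simp add: power2_eq_square algebra_simps)
  also have "\<dots> \<le> 4" using consec_dirichlet[OF c] by simp
  finally show ?thesis .
qed

lemma shear_nonzero:
  assumes "consec u v"
  shows "shear (fst \<circ> snd) u v \<noteq> 0 \<or> shear (snd \<circ> snd) u v \<noteq> 0"
proof -
  obtain u0 u1 u2 v0 v1 v2 where uv: "u = (u0, u1, u2)" "v = (v0, v1, v2)" by (metis prod_cases3)
  have "0 < \<bar>L u\<bar> * of_int (height v) / 2" using consec_pos[OF assms] by simp
  also have "\<dots> \<le> max \<bar>shear (fst \<circ> snd) u v\<bar> \<bar>shear (snd \<circ> snd) u v\<bar>"
    using consec_transversal assms unfolding uv shear_def by (simp del: L_simp)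
  finally show ?thesis by (simp add: less_max_iff_disj)
qed

text \<open>By \<open>det_eq\<close> the difference of the two sides is \<open>p v\<close> times the
  determinant.\<close>

lemma shear_cross:
  assumes "det u v w = 0" and p: "p = fst \<circ> snd \<or> p = snd \<circ> snd"
  shows "shear p u v * of_int (cross v w) = shear p v w * of_int (cross u v)"
proof -
  obtain u0 u1 u2 v0 v1 v2 w0 w1 w2 where uv: "u = (u0, u1, u2)" "v = (v0, v1, v2)" "w = (w0, w1, w2)"
    by (metis prod_cases3)
  have "shear p u v * of_int (cross v w) - shear p v w * of_int (cross u v)
    = of_int (p v) * (L u * of_int (cross v w) - L v * of_int (cross u w) + L w * of_int (cross u v))"
    using p unfolding uv shear_def cross_simp by (auto simp add: algebra_simps simp del: L_simp)
  also have "\<dots> = 0" unfolding det_eq[symmetric] using assms(1) by simp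
  finally show ?thesis by simp
qed

text \<open>If \<open>cross u v = 0\<close>, both shears are integers; \<open>shear_bound\<close>
  and height above 4 make them smaller than 1, hence 0, against
  \<open>shear_nonzero\<close>.\<close>

lemma cross_nonzero:
  assumes c: "consec u v" and big: "height v > 4"
  shows "cross u v \<noteq> 0"
proof
  assume 0: "cross u v = 0"
  obtain u0 u1 u2 v0 v1 v2 where uv: "u = (u0, u1, u2)" "v = (v0, v1, v2)" by (metis prod_cases3)
  have "shear p u v = 0" if p: "p = fst \<circ> snd \<or> p = snd \<circ> snd" for p
  proof -
    have "\<bar>p z\<bar> \<le> height z" for z using p by (cases z rule: prod_cases3) auto
    then have "\<bar>shear p u v\<bar> * of_int (height v) \<le> 4" by (rule shear_bound[OF c])
    moreover have "\<bar>shear p u v\<bar> * 4 \<le> \<bar>shear p u v\<bar> * of_int (height v)"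
      using big by (intro mult_left_mono) simp_all
    ultimately have le1: "\<bar>shear p u v\<bar> * of_int (height v) \<le> 4" "\<bar>shear p u v\<bar> \<le> 1" by simp_all
    have ne1: "\<bar>shear p u v\<bar> \<noteq> 1" using le1(1) big by auto
    have r: "real_of_int u1 * of_int v2 = of_int u2 * of_int v1"
      using 0 unfolding uv cross_simp by (simp flip: of_int_mult)
    \<comment> \<open>The term in \<open>p\<close> itself cancels by antisymmetry, and the other
      irrational term is a multiple of \<open>cross u v\<close>.\<close>
    have "shear p u v = of_int (u0 * p v - v0 * p u)"
      using p
    proof
      assume p: "p = fst \<circ> snd"
      have "shear p u v = of_int (u0 * p v - v0 * p u) + \<beta> * (of_int u2 * of_int v1 - of_int u1 * of_int v2)"
        unfolding p shear_def uv by (simp add: algebra_simps)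
      then show ?thesis using r by simp
    next
      assume p: "p = snd \<circ> snd"
      have "shear p u v = of_int (u0 * p v - v0 * p u) + \<alpha> * (of_int u1 * of_int v2 - of_int u2 * of_int v1)"
        unfolding p shear_def uv by (simp add: algebra_simps)
      then show ?thesis using r by simp
    qed
    then obtain k :: int where k: "shear p u v = of_int k" by blast
    then have "\<bar>real_of_int k\<bar> < 1" using le1(2) ne1 by linarith
    then have "k = 0" by linarith
    then show ?thesis using k by simp
  qed
  then show False using shear_nonzero[OF c] by blast
qed

lemma consec_sequence_height:
  assumes "\<And>n. consec (f n) (f (Suc n))"
  shows "int n \<le> height (f n)"
proof (induction n)
  case (Suc n)
  then show ?case using consec_pos(5)[OF assms[of n]] by simp
qed (simp add: height_nonneg)

text \<open>If \<open>det\<close> vanished from some index on, all later approximations would lie in a fixed plane, so the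
  ratio of \<open>shear\<close> to \<open>cross\<close> would be constant, although it tends to \<open>0\<close>.\<close>

lemma independent_triple:
  assumes f: "\<And>n. consec (f n) (f (Suc n))"
  shows "\<exists>n \<ge> N. det (f n) (f (Suc n)) (f (Suc (Suc n))) \<noteq> 0"
proof (rule ccontr)
  assume neg: "\<not> ?thesis"
  note hn = consec_sequence_height[of f, OF f]
  \<comment> \<open>The shift by 4 lifts \<open>height (f (Suc n))\<close> above 4, as
    \<open>cross_nonzero\<close> requires.\<close>
  define M where "M = N + 4"
  have cr: "cross (f n) (f (Suc n)) \<noteq> 0" if "n \<ge> M" for n
    using hn[of "Suc n"] that by (intro cross_nonzero f) (simp add: M_def)
  have "shear p (f M) (f (Suc M)) = 0" if p: "p = fst \<circ> snd \<or> p = snd \<circ> snd" for p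
  proof -
    define r where "r = (\<lambda>n. shear p (f n) (f (Suc n)) / of_int (cross (f n) (f (Suc n))))"
    have "r (Suc n) = r n" if "n \<ge> M" for n
    proof -
      have "det (f n) (f (Suc n)) (f (Suc (Suc n))) = 0" using neg that by (auto simp: M_def)
      from shear_cross[OF this p] show ?thesis
        using cr[of n] cr[of "Suc n"] that unfolding r_def by (simp add: frac_eq_eq)
    qed
    then have const: "r (M + n) = r M" for n by (induction n) auto
    have "\<bar>r M\<bar> * real n \<le> 4" for n
    proof -
      let ?u = "f (M + n)" and ?v = "f (Suc (M + n))"
      have "1 \<le> \<bar>cross ?u ?v\<bar>" using cr[of "M + n"] by linarith
      then have c1: "1 \<le> \<bar>real_of_int (cross ?u ?v)\<bar>" by linarith
      have "\<bar>r (M + n)\<bar> = \<bar>shear p ?u ?v\<bar> / \<bar>real_of_int (cross ?u ?v)\<bar>" by (simp add: r_def)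
      also have "\<dots> \<le> \<bar>shear p ?u ?v\<bar> / 1" using c1 by (intro divide_left_mono) simp_all
      finally have "\<bar>r M\<bar> \<le> \<bar>shear p ?u ?v\<bar>" unfolding const by simp
      moreover have "real n \<le> of_int (height ?v)" using hn[of "Suc (M + n)"] by linarith
      ultimately have "\<bar>r M\<bar> * real n \<le> \<bar>shear p ?u ?v\<bar> * of_int (height ?v)"
        by (intro mult_mono) simp_all
      also have "\<dots> \<le> 4"
      proof (rule shear_bound[OF f])
        show "\<bar>p z\<bar> \<le> height z" for z using p by (cases z rule: prod_cases3) auto
      qed
      finally show ?thesis .
    qed
    then have "r M = 0" using ex_less_of_nat_mult[of "\<bar>r M\<bar>" 4] by (metis abs_le_zero_iff mult.commute not_le)
    then show ?thesis using cr[of M] by (simp add: r_def)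
  qed
  then show False using shear_nonzero[OF f[of M]] by blast
qed

lemma independent_triples:
  "\<exists>t u v. consec t u \<and> consec u v \<and> det t u v \<noteq> 0 \<and> B \<le> height u"
proof -
  obtain f where f: "\<And>n. consec (f n) (f (Suc n))" using best_sequence by blast
  note hn = consec_sequence_height[of f, OF f]
  obtain n where "n \<ge> nat B" "det (f n) (f (Suc n)) (f (Suc (Suc n))) \<noteq> 0"
    using independent_triple[of f, OF f] by blast
  moreover have "B \<le> height (f (Suc n))" using hn[of "Suc n"] \<open>n \<ge> nat B\<close> by linarith
  ultimately show ?thesis using f by blast
qed

end

section \<open>The exponent\<close>

lemma golden_gt_1: "golden > 1"
proof -
  have "sqrt 1 < sqrt 5" by (rule real_sqrt_less_mono) simp
  then show ?thesis by (simp add: golden_def)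
qed

lemma golden_square: "golden\<^sup>2 = golden + 1"
proof -
  have "(sqrt 5)\<^sup>2 = (5 :: real)" by simp
  then show ?thesis by (simp add: golden_def power2_eq_square field_simps)
qed

lemma golden_denominator_pos:
  assumes "\<gamma> \<ge> 2"
  shows "golden\<^sup>2 * \<gamma> - 2 > 0"
proof -
  have "2 * 2 < golden\<^sup>2 * 2" using golden_gt_1 by (simp add: golden_square)
  also have "\<dots> \<le> golden\<^sup>2 * \<gamma>" using assms by (intro mult_left_mono) simp_all
  finally show ?thesis by simp
qed

lemma g_ge_golden: "\<gamma> \<ge> 2 \<Longrightarrow> golden \<le> g \<gamma>"
  using golden_denominator_pos[of \<gamma>] golden_gt_1 by (simp add: g_def)

lemma g_equation:
  assumes "\<gamma> \<ge> 2"
  shows "golden\<^sup>2 * \<gamma> * (g \<gamma> - golden) = 2 * (g \<gamma> - 1)"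
proof -
  have "(g \<gamma> - golden) * (golden\<^sup>2 * \<gamma> - 2) = 2 * golden - 2"
    using golden_denominator_pos[OF assms] by (simp add: g_def)
  then show ?thesis by (simp add: algebra_simps)
qed

text \<open>Putting 2 for \<gamma> on the left of \<open>g_equation\<close> leaves a linear
  inequality in \<open>g \<gamma>\<close>; equality occurs at \<gamma> = 2.\<close>

lemma g_le_2:
  assumes "\<gamma> \<ge> 2"
  shows "g \<gamma> \<le> 2"
proof -
  have "golden\<^sup>2 * 2 * (g \<gamma> - golden) \<le> golden\<^sup>2 * \<gamma> * (g \<gamma> - golden)"
    using assms g_ge_golden[OF assms] by (intro mult_right_mono mult_left_mono) simp_all
  also have "\<dots> = 2 * (g \<gamma> - 1)" by (rule g_equation[OF assms])
  finally have "(golden + 1) * g \<gamma> - golden\<^sup>2 * golden \<le> g \<gamma> - 1"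
    by (simp add: golden_square algebra_simps)
  moreover have "golden\<^sup>2 * golden = 2 * golden + 1"
    using golden_square by (simp add: power2_eq_square algebra_simps)
  ultimately have "golden * g \<gamma> \<le> golden * 2" by (simp add: algebra_simps)
  then show ?thesis using golden_gt_1 by simp
qed

text \<open>The quadratic has the roots \<open>golden\<close> and \<open>1 - golden\<close>. After
  factoring, \<open>g_equation\<close> removes \<gamma>, and what remains factors with
  \<open>2 - e\<close>, nonnegative by \<open>g_le_2\<close>.\<close>

lemma g_quadratic:
  assumes "\<gamma> \<ge> 2"
  shows "g \<gamma> * (g \<gamma> - 1) - 1 \<le> g \<gamma> / \<gamma>"
proof -
  define e t where "e = g \<gamma>" and "t = golden"
  have e: "t \<le> e" "e \<le> 2" and t: "t > 1" "t\<^sup>2 = t + 1"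
    using g_ge_golden[OF assms] g_le_2[OF assms] golden_gt_1 golden_square by (simp_all add: e_def t_def)
  have tt: "t * t = t + 1" using t(2) by (simp add: power2_eq_square)
  have split: "e * (e - 1) - 1 = (e - t) * (e + t - 1)" using tt by (simp add: algebra_simps)
  have "t\<^sup>2 * e - 2 * (e - 1) * (e + t - 1) = (2 - e) * (2 * e + t - 1)"
    unfolding t(2) by (simp add: algebra_simps)
  moreover have "(2 - e) * (2 * e + t - 1) \<ge> 0" using e t by (intro mult_nonneg_nonneg) simp_all
  ultimately have key: "2 * (e - 1) * (e + t - 1) \<le> t\<^sup>2 * e" by linarith
  have "t\<^sup>2 * (\<gamma> * (e * (e - 1) - 1)) = (t\<^sup>2 * \<gamma> * (e - t)) * (e + t - 1)"
    unfolding split by (simp add: algebra_simps)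
  also have "\<dots> = 2 * (e - 1) * (e + t - 1)" using g_equation[OF assms] by (simp add: e_def t_def)
  also have "\<dots> \<le> t\<^sup>2 * e" by (rule key)
  finally have "\<gamma> * (e * (e - 1) - 1) \<le> e" using t by simp
  then show ?thesis using assms unfolding e_def by (simp add: field_simps)
qed

lemma C_eq: "C \<gamma> \<Gamma> = 2 ^ 18 * \<Gamma> powr (- 1 / (golden\<^sup>2 * \<gamma> - 2))"
  by (simp add: C_def golden_square)

text \<open>\<open>A\<close> and \<open>B\<close> say that the points of \<open>positive_combination\<close> and \<open>coset_point\<close> are not solutions.\<close>

lemma failures_contradict:
  fixes l X Y \<Gamma> \<gamma> :: real
  assumes \<Gamma>: "0 < \<Gamma>" "\<Gamma> < 1" and \<gamma>: "\<gamma> \<ge> 2" and pos: "l > 0" "X > 0" "Y \<ge> 1"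
    and lower: "l \<ge> \<Gamma> / X powr \<gamma>"
    and A: "2 ^ 6 * (Y / X * l) * Y powr g \<gamma> > C \<gamma> \<Gamma>"
    and B: "2 ^ 12 * l * (1 / (l * Y)) powr g \<gamma> > C \<gamma> \<Gamma>"
  shows False
proof -
  define e where "e = g \<gamma>"
  define G where "G = - ln \<Gamma>"
  define d where "d = golden\<^sup>2 * \<gamma> - 2"
  define \<kappa> where "\<kappa> = G / d"
  \<comment> \<open>\<open>c\<close> is the logarithm of the size of the coset point, up to a
    constant factor; \<kappa> is what \<Gamma> contributes to the logarithm of
    \<open>C\<close>.\<close>
  define a b c where "a = ln X" and "b = ln Y" and "c = - ln (l * Y)"
  have d: "d > 0" using golden_denominator_pos[OF \<gamma>] by (simp add: d_def)
  have G: "G > 0" using \<Gamma> by (simp add: G_def)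
  have \<kappa>: "\<kappa> > 0" using d G by (simp add: \<kappa>_def)
  have e: "golden \<le> e" "e \<le> 2" "e > 1"
    using g_ge_golden[OF \<gamma>] g_le_2[OF \<gamma>] golden_gt_1 by (simp_all add: e_def)
  have b: "b \<ge> 0" using pos by (simp add: b_def)
  have l: "ln l = - c - b" using pos by (simp add: c_def b_def ln_mult)
  have C0: "C \<gamma> \<Gamma> > 0" using \<Gamma> by (simp add: C_eq)
  have lnC: "ln (C \<gamma> \<Gamma>) = 18 * ln 2 + \<kappa>"
    using \<Gamma> ln_realpow[of "2 :: real" 18] by (simp add: C_eq ln_mult ln_powr \<kappa>_def G_def d_def)
  have l2: "ln 2 > (0 :: real)" by simp
  have "ln (C \<gamma> \<Gamma>) < ln (2 ^ 6 * (Y / X * l) * Y powr g \<gamma>)"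
    using A C0 by (subst ln_less_cancel_iff) linarith+
  also have "\<dots> = 6 * ln 2 + (b - a + ln l) + e * b"
    using pos ln_realpow[of "2 :: real" 6] by (simp add: ln_mult ln_div ln_powr a_def b_def e_def)
  finally have A': "12 * ln 2 + \<kappa> + c + a < e * b" unfolding lnC l by linarith
  have "ln (C \<gamma> \<Gamma>) < ln (2 ^ 12 * l * (1 / (l * Y)) powr g \<gamma>)"
    using B C0 by (subst ln_less_cancel_iff) linarith+
  also have "\<dots> = 12 * ln 2 + ln l + e * c"
    using pos ln_realpow[of "2 :: real" 12] by (simp add: ln_mult ln_div ln_powr c_def e_def)
  finally have B': "6 * ln 2 + \<kappa> + b < (e - 1) * c" unfolding lnC l by (simp add: algebra_simps)
  have "ln (\<Gamma> / X powr \<gamma>) \<le> ln l" using lower \<Gamma> pos by (subst ln_le_cancel_iff) simp_all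
  then have "- G - \<gamma> * a \<le> - c - b" using \<Gamma> pos unfolding l by (simp add: ln_div ln_powr G_def a_def)
  then have low: "(c + b - G) / \<gamma> \<le> a" using \<gamma> by (simp add: field_simps)
  have c: "c > 0"
  proof -
    have "0 < (e - 1) * c" using B' b \<kappa> l2 by linarith
    then show ?thesis using e by (simp add: zero_less_mult_iff)
  qed
  have \<gamma>1: "1 / \<gamma> \<le> 1 / 2" using \<gamma> by (simp add: field_simps)
  \<comment> \<open>The coefficient of \<open>b\<close> once \<open>a\<close> has been eliminated by
    \<open>low\<close>.\<close>
  define h where "h = e - 1 / \<gamma>"
  have h: "h > 0" using e \<gamma>1 by (simp add: h_def)
  have "\<kappa> + c + (c + b - G) / \<gamma> < e * b" using A' low l2 by linarith
  then have 1: "\<kappa> + (1 + 1 / \<gamma>) * c - G / \<gamma> < h * b"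
    by (simp add: h_def algebra_simps add_divide_distrib diff_divide_distrib)
  have "b \<le> (e - 1) * c - \<kappa>" using B' l2 by linarith
  then have "h * b \<le> h * ((e - 1) * c - \<kappa>)" using h by (intro mult_left_mono) simp_all
  \<comment> \<open>Eliminating \<open>b\<close> by \<open>B'\<close> leaves only \<open>c\<close>,
    whose coefficient is nonpositive exactly by \<open>g_quadratic\<close>.\<close>
  with 1 have "(1 + h) * \<kappa> - G / \<gamma> < (h * (e - 1) - (1 + 1 / \<gamma>)) * c" by (simp add: algebra_simps)
  also have "\<dots> \<le> 0"
  proof (rule mult_nonpos_nonneg)
    have "h * (e - 1) - (1 + 1 / \<gamma>) = e * (e - 1) - 1 - e / \<gamma>"
      by (simp add: h_def algebra_simps diff_divide_distrib)
    then show "h * (e - 1) - (1 + 1 / \<gamma>) \<le> 0" using g_quadratic[OF \<gamma>] by (simp add: e_def)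
  qed (use c in simp)
  \<comment> \<open>Here the exponent of \<Gamma> in \<open>C\<close> decides:
    \<open>(1 + h) * \<gamma>\<close> is at least \<open>golden\<^sup>2 * \<gamma> - 1\<close>,
    which exceeds \<open>d\<close>.\<close>
  finally have "(1 + h) * \<kappa> < G / \<gamma>" by simp
  then have "G * ((1 + h) * \<gamma>) < G * d" using d \<gamma> by (simp add: \<kappa>_def field_simps)
  then have "(1 + h) * \<gamma> < d" using G by (simp only: mult_less_cancel_left_pos)
  moreover have "(1 + h) * \<gamma> = \<gamma> + e * \<gamma> - 1" using \<gamma> by (simp add: h_def algebra_simps)
  moreover have "golden * \<gamma> \<le> e * \<gamma>" using e \<gamma> by (intro mult_right_mono) simp_all
  ultimately show False by (simp add: d_def golden_square algebra_simps)
qed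

section \<open>From the estimates to infinitely many solutions\<close>

lemma C_ge:
  assumes "0 < \<Gamma>" "\<Gamma> < 1" "\<gamma> \<ge> 2"
  shows "2 ^ 18 \<le> C \<gamma> \<Gamma>"
proof -
  have "\<Gamma> powr 0 \<le> \<Gamma> powr (- 1 / (golden\<^sup>2 * \<gamma> - 2))"
    using assms golden_denominator_pos[OF assms(3)] by (intro powr_mono') simp_all
  then show ?thesis using assms(1) by (simp add: C_eq)
qed

lemma dist_to_int_le: "dist_to_int (\<alpha> * of_int b + \<beta> * of_int c) \<le> \<bar>of_int a + \<alpha> * of_int b + \<beta> * of_int c\<bar>"
proof -
  have "infdist (\<alpha> * of_int b + \<beta> * of_int c) \<int> \<le> dist (\<alpha> * of_int b + \<beta> * of_int c) (of_int (- a))"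
    by (rule infdist_le) (rule Ints_of_int)
  then show ?thesis by (simp add: dist_to_int_def dist_real_def algebra_simps)
qed

lemma powr_le_square:
  fixes x e :: real
  assumes "x \<ge> 1" "e \<le> 2"
  shows "x powr e \<le> x ^ 2"
proof -
  have "x powr e \<le> x powr 2" using assms(2,1) by (rule powr_mono)
  then show ?thesis using assms by simp
qed

context linear_form
begin

text \<open>The parameter \<delta> forces the solutions to have arbitrarily small values, from which
  infinitely many distinct ones are extracted later.\<close>

lemma solution_exists:
  assumes \<Gamma>: "0 < \<Gamma>" "\<Gamma> < 1" and \<gamma>: "\<gamma> \<ge> 2" and \<delta>: "\<delta> > 0"
    and lower: "\<And>z. height z > 0 \<Longrightarrow> \<bar>L z\<bar> \<ge> \<Gamma> / of_int (height z) powr \<gamma>"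
  shows "\<exists>x0 x1 x2. 0 < x1 \<and> 0 < x2 \<and> \<bar>L (x0, x1, x2)\<bar> < \<delta> \<and>
    \<bar>L (x0, x1, x2)\<bar> * of_int (max x1 x2) powr g \<gamma> \<le> C \<gamma> \<Gamma>"
proof (rule ccontr)
  assume neg: "\<not> ?thesis"
  define e where "e = g \<gamma>"
  have e: "1 < e" "e \<le> 2"
    using g_ge_golden[OF \<gamma>] g_le_2[OF \<gamma>] golden_gt_1 by (simp_all add: e_def)
  \<comment> \<open>The assumed absence of solutions, in terms of upper bounds \<open>r\<close> for
    the value and \<open>N\<close> for the coordinates.\<close>
  have fail: "C \<gamma> \<Gamma> < r * N powr e"
    if "0 < x1" "0 < x2" "\<bar>L (x0, x1, x2)\<bar> \<le> r" "r < \<delta>" "of_int x1 \<le> N" "of_int x2 \<le> N"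
    for x0 x1 x2 r N
  proof -
    have "\<bar>L (x0, x1, x2)\<bar> < \<delta>" using that(3,4) by linarith
    then have "C \<gamma> \<Gamma> < \<bar>L (x0, x1, x2)\<bar> * of_int (max x1 x2) powr e"
      using neg that(1,2) unfolding e_def by (meson not_le)
    also have "\<dots> \<le> r * N powr e"
      using that e by (intro mult_mono powr_mono2) (auto simp: max_def)
    finally show ?thesis .
  qed
  \<comment> \<open>From \<open>l Y <= l Y^2 <= 2\<close>, the value bound
    \<open>7 (Y / X) l\<close> is at most \<open>14 / X\<close>; a height above
    \<open>14 / \<delta>\<close> puts it, and \<open>l\<close>, below \<delta>.\<close>
  obtain t u v where tu: "consec t u" and uv: "consec u v" and det: "det t u v \<noteq> 0"
    and big: "\<lceil>14 / \<delta>\<rceil> + 1 \<le> height u"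
    using independent_triples by blast
  obtain u0 u1 u2 v0 v1 v2 where uveq: "u = (u0, u1, u2)" "v = (v0, v1, v2)" by (metis prod_cases3)
  define X where "X = real_of_int (height u)"
  define Y where "Y = real_of_int (height v)"
  define l where "l = \<bar>L u\<bar>"
  have X: "X > 14 / \<delta>" "X \<ge> 1" using big consec_pos(1)[OF tu] unfolding X_def by linarith+
  have Y: "Y \<ge> X" "Y \<ge> 1" using consec_pos(5)[OF uv] X(2) unfolding X_def Y_def by linarith+
  have l: "l > 0" "\<bar>L v\<bar> \<le> l" "l * Y ^ 2 \<le> 2"
    using consec_pos[OF uv] consec_dirichlet[OF uv] unfolding l_def Y_def by simp_all
  have "14 < X * \<delta>" using X \<delta> by (simp add: field_simps)
  moreover have lYX: "Y / X * l * X \<le> 2"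
  proof -
    have "Y / X * l * X = l * Y" using X by simp
    also have "\<dots> \<le> l * Y ^ 2" using l Y by (intro mult_left_mono) (simp_all add: self_le_power)
    finally show ?thesis using l by linarith
  qed
  ultimately have "7 * (Y / X * l * X) < X * \<delta>" by linarith
  then have "7 * (Y / X * l) * X < \<delta> * X" by (simp only: mult.assoc mult.commute[of \<delta>])
  then have small2: "7 * (Y / X * l) < \<delta>" using X by (simp only: mult_less_cancel_right_pos)
  have YX: "1 \<le> Y / X" using X Y by simp
  have "l \<le> Y / X * l" using YX l mult_right_mono[of 1 "Y / X" l] by simp
  then have small1: "l < \<delta>" using small2 l by linarith
  have C18: "2 ^ 18 \<le> C \<gamma> \<Gamma>" by (rule C_ge[OF \<Gamma> \<gamma>])
  \<comment> \<open>The constant absorbs \<open>38 powr e <= 38^2 < 2^12\<close>.\<close>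
  have B: "2 ^ 12 * l * (1 / (l * Y)) powr e > C \<gamma> \<Gamma>"
  proof -
    obtain x0 x1 x2 where x: "height v \<le> x1" "height v \<le> x2" "of_int x1 \<le> 38 / (l * Y)" "of_int x2 \<le> 38 / (l * Y)"
      "\<bar>L (x0, x1, x2)\<bar> \<le> l"
      using coset_point[OF uv[unfolded uveq]] unfolding l_def Y_def uveq height_simp by blast
    have "0 < x1" "0 < x2" using x(1,2) consec_pos(1)[OF uv] by linarith+
    from fail[OF this x(5) small1 x(3,4)] have "C \<gamma> \<Gamma> < l * (38 * (1 / (l * Y))) powr e" by simp
    also have "\<dots> = l * (38 powr e * (1 / (l * Y)) powr e)" using l Y by (subst powr_mult) simp_all
    also have "\<dots> \<le> l * (2 ^ 12 * (1 / (l * Y)) powr e)"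
      using powr_le_square[of 38 e] e l by (intro mult_left_mono mult_right_mono) simp_all
    finally show ?thesis by (simp add: mult_ac)
  qed
  \<comment> \<open>Otherwise the left side of \<open>B\<close> is at most
    \<open>2^12 * 64 = 2^18\<close>, against \<open>C_ge\<close>; this accounts for the constant in
    \<open>C\<close>.\<close>
  have lY: "l * Y ^ 2 \<le> 1 / 64"
  proof (rule ccontr)
    define q where "q = l * Y ^ 2"
    assume "\<not> ?thesis"
    then have q: "q > 0" "1 / q \<le> 64" by (simp_all add: q_def field_simps)
    have "1 / (l * Y) = Y * (1 / q)" using l Y by (simp add: q_def power2_eq_square)
    then have "l * (1 / (l * Y)) powr e = l * Y powr e * (1 / q) powr e"
      using q Y by (simp add: powr_mult powr_divide)
    also have "\<dots> \<le> l * Y ^ 2 * (1 / q) powr e"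
      using powr_le_square[OF Y(2) e(2)] l by (intro mult_right_mono mult_left_mono) simp_all
    also have "\<dots> = (1 / q) powr (e - 1)"
      using q(1) unfolding q_def[symmetric] by (simp add: powr_diff)
    also have "\<dots> \<le> 64 powr (e - 1)" using q e by (intro powr_mono2) simp_all
    also have "\<dots> \<le> 64 powr 1" using e by (intro powr_mono) simp_all
    finally have "2 ^ 12 * (l * (1 / (l * Y)) powr e) \<le> 2 ^ 18" by simp
    then show False using B C18 by (simp add: mult.assoc)
  qed
  have easy: "l * N powr e \<le> C \<gamma> \<Gamma>" if "1 \<le> N" "N \<le> Y" for N
  proof -
    have "N powr e \<le> N ^ 2" using that e by (intro powr_le_square)
    also have "\<dots> \<le> Y ^ 2" using that by (intro power_mono) simp_all
    finally have "l * N powr e \<le> l * Y ^ 2" using l by (intro mult_left_mono) simp_all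
    then show ?thesis using lY C18 by simp
  qed
  \<comment> \<open>With both coordinates of the same strict sign, the vector or its negative would
    already be a solution by \<open>easy\<close>.\<close>
  have opp: "b * c \<le> 0" if b: "\<bar>L (a, b, c)\<bar> \<le> l" "of_int (height (a, b, c)) \<le> Y" for a b c
  proof (rule ccontr)
    assume "\<not> b * c \<le> 0"
    then have "0 < b * c" by simp
    then have "(0 < b \<and> 0 < c) \<or> (0 < - b \<and> 0 < - c)" by (simp add: zero_less_mult_iff)
    moreover have "\<bar>L (- a, - b, - c)\<bar> = \<bar>L (a, b, c)\<bar>"
    proof -
      have "L (- a, - b, - c) = - L (a, b, c)" by simp
      then show ?thesis by (simp only: abs_minus_cancel)
    qed
    moreover have h: "\<bar>b\<bar> \<le> height (a, b, c)" "\<bar>c\<bar> \<le> height (a, b, c)" by simp_all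
    then have "\<bar>real_of_int b\<bar> \<le> Y" "\<bar>real_of_int c\<bar> \<le> Y" using b(2) by linarith+
    then have "real_of_int b \<le> Y" "real_of_int c \<le> Y" "real_of_int (- b) \<le> Y" "real_of_int (- c) \<le> Y"
      by simp_all
    ultimately have "C \<gamma> \<Gamma> < l * Y powr e"
      using fail[of b c a l Y] fail[of "- b" "- c" "- a" l Y] small1 b(1) by metis
    then show False using easy[of Y] Y(2) by simp
  qed
  have opp_u: "u1 * u2 \<le> 0" using opp[of u0 u1 u2] Y(1) by (simp add: l_def X_def uveq del: L_simp height_simp)
  have opp_v: "v1 * v2 \<le> 0" using opp[of v0 v1 v2] l(2) by (simp add: Y_def uveq del: L_simp height_simp)
  have "3 * \<bar>cross u v\<bar> > height u ^ 2"
    using cross_large[OF tu uv det] lY unfolding l_def Y_def by simp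
  then obtain x0 x1 x2 where x: "0 < x1" "0 < x2" "x1 \<le> 3 * height v" "x2 \<le> 3 * height v"
    "\<bar>L (x0, x1, x2)\<bar> * X \<le> 7 * Y * l"
    using positive_combination[OF uv[unfolded uveq] opp_u opp_v]
    unfolding X_def Y_def l_def uveq height_simp cross_simp by auto
  have "\<bar>L (x0, x1, x2)\<bar> \<le> 7 * (Y / X * l)" using x(5) X(2) by (simp add: field_simps)
  moreover have "real_of_int x1 \<le> 3 * Y" "real_of_int x2 \<le> 3 * Y" using x(3,4) unfolding Y_def by linarith+
  ultimately have "C \<gamma> \<Gamma> < 7 * (Y / X * l) * (3 * Y) powr e" using fail x(1,2) small2 by blast
  also have "\<dots> = 7 * (Y / X * l) * (3 powr e * Y powr e)" using Y by (subst powr_mult) simp_all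
  \<comment> \<open>The factors 7 and 9 combine to 63, just below \<open>2^6\<close>.\<close>
  also have "\<dots> \<le> 7 * (Y / X * l) * (3 ^ 2 * Y powr e)"
    using powr_le_square[of 3 e] e X Y l by (intro mult_left_mono mult_right_mono) simp_all
  also have "\<dots> = 63 * (Y / X * l * Y powr e)" by simp
  also have "\<dots> \<le> 64 * (Y / X * l * Y powr e)" using X Y l by (intro mult_right_mono) simp_all
  finally have A: "2 ^ 6 * (Y / X * l) * Y powr e > C \<gamma> \<Gamma>" by (simp add: mult_ac)
  have "l \<ge> \<Gamma> / X powr \<gamma>" using lower[of u] consec_pos(1)[OF tu] unfolding l_def X_def .
  then show False
    using failures_contradict[OF \<Gamma> \<gamma> l(1) _ Y(2) _ A[unfolded e_def] B[unfolded e_def]] X(2) by simp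
qed

end

text \<open>Each choice takes the previous positive value as the next \<delta>, so the values
  strictly decrease and the points are distinct.\<close>

lemma infinitely_many_of_arbitrarily_small:
  fixes \<phi> :: "'a \<Rightarrow> real"
  assumes "\<And>\<delta>. \<delta> > 0 \<Longrightarrow> \<exists>x. P x \<and> \<phi> x < \<delta>" and pos: "\<And>x. P x \<Longrightarrow> \<phi> x > 0"
  shows "\<exists>f :: nat \<Rightarrow> 'a. inj f \<and> (\<forall>n. P (f n))"
proof -
  have "\<exists>f. \<forall>n. P (f n) \<and> \<phi> (f (Suc n)) < \<phi> (f n)"
    using assms(1)[of 1] assms(1)[OF pos] by (intro dependent_nat_choice) auto
  then obtain f where f: "\<And>n. P (f n)" "\<And>n. \<phi> (f (Suc n)) < \<phi> (f n)" by blast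
  have "\<phi> (f m) < \<phi> (f n)" if "n < m" for n m
    using lift_Suc_mono_less[of "\<lambda>n. - \<phi> (f n)" n m] f(2) that by simp
  then have "inj f" by (intro linorder_injI) fastforce
  then show ?thesis using f(1) by blast
qed

text \<open>Infinitude is expressed by injectivity of the sequence of pairs, which rules out
  repetition.\<close>

theorem theorem2:
  fixes \<alpha>\<^sub>1 \<alpha>\<^sub>2 \<Gamma> \<gamma> :: real
  assumes "0 < \<Gamma>" and "\<Gamma> < 1" and "\<gamma> \<ge> 2"
    and "\<And>m\<^sub>1 m\<^sub>2 :: int. (m\<^sub>1, m\<^sub>2) \<noteq> (0, 0) \<Longrightarrow>
      dist_to_int (\<alpha>\<^sub>1 * of_int m\<^sub>1 + \<alpha>\<^sub>2 * of_int m\<^sub>2)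
        \<ge> \<Gamma> / of_int (max \<bar>m\<^sub>1\<bar> \<bar>m\<^sub>2\<bar>) powr \<gamma>"
  shows "\<exists>x\<^sub>1 x\<^sub>2 :: nat \<Rightarrow> int. inj (\<lambda>i. (x\<^sub>1 i, x\<^sub>2 i)) \<and>
    (\<forall>i. x\<^sub>1 i > 0 \<and> x\<^sub>2 i > 0 \<and>
      dist_to_int (\<alpha>\<^sub>1 * of_int (x\<^sub>1 i) + \<alpha>\<^sub>2 * of_int (x\<^sub>2 i))
        * of_int (max (x\<^sub>1 i) (x\<^sub>2 i)) powr g \<gamma> \<le> C \<gamma> \<Gamma>)"
proof -
  let ?d = "\<lambda>(x\<^sub>1, x\<^sub>2). dist_to_int (\<alpha>\<^sub>1 * real_of_int x\<^sub>1 + \<alpha>\<^sub>2 * real_of_int x\<^sub>2)"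
  define P where "P = (\<lambda>(x\<^sub>1, x\<^sub>2). x\<^sub>1 > 0 \<and> x\<^sub>2 > 0 \<and>
      ?d (x\<^sub>1, x\<^sub>2) * of_int (max x\<^sub>1 x\<^sub>2) powr g \<gamma> \<le> C \<gamma> \<Gamma>)"
  have pos: "?d (b, c) > 0" if "(b, c) \<noteq> (0, 0)" for b c
  proof -
    have "max \<bar>b\<bar> \<bar>c\<bar> > 0" using that by auto
    then have "\<Gamma> / of_int (max \<bar>b\<bar> \<bar>c\<bar>) powr \<gamma> > 0" using assms(1) by simp
    then show ?thesis using assms(4)[OF that] by simp
  qed
  \<comment> \<open>The Diophantine lower bound makes the distance to the integers positive, which
    yields the independence required by the locale.\<close>
  interpret linear_form \<alpha>\<^sub>1 \<alpha>\<^sub>2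
  proof
    fix a b c :: int
    assume "(b, c) \<noteq> (0, 0)"
    from pos[OF this] show "real_of_int a + \<alpha>\<^sub>1 * of_int b + \<alpha>\<^sub>2 * of_int c \<noteq> 0"
      using dist_to_int_le[of \<alpha>\<^sub>1 b \<alpha>\<^sub>2 c a] by auto
  qed
  have lower: "\<bar>L z\<bar> \<ge> \<Gamma> / of_int (height z) powr \<gamma>" if z: "height z > 0" for z
  proof -
    obtain a b c where abc: "z = (a, b, c)" by (metis prod_cases3)
    then have "(b, c) \<noteq> (0, 0)" using z by auto
    from assms(4)[OF this] show ?thesis
      using dist_to_int_le[of \<alpha>\<^sub>1 b \<alpha>\<^sub>2 c a] unfolding abc L_simp height_simp by linarith
  qed
  have small: "\<exists>x. P x \<and> ?d x < \<delta>" if \<delta>: "\<delta> > 0" for \<delta>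
  proof -
    obtain x0 x1 x2 where x: "0 < x1" "0 < x2" "\<bar>L (x0, x1, x2)\<bar> < \<delta>"
      "\<bar>L (x0, x1, x2)\<bar> * of_int (max x1 x2) powr g \<gamma> \<le> C \<gamma> \<Gamma>"
      using solution_exists[OF assms(1-3) \<delta> lower] by blast
    have d: "?d (x1, x2) \<le> \<bar>L (x0, x1, x2)\<bar>"
      using dist_to_int_le[of \<alpha>\<^sub>1 x1 \<alpha>\<^sub>2 x2 x0] by simp
    then have "?d (x1, x2) * of_int (max x1 x2) powr g \<gamma> \<le> \<bar>L (x0, x1, x2)\<bar> * of_int (max x1 x2) powr g \<gamma>"
      by (rule mult_right_mono) simp
    then have "P (x1, x2)" using x unfolding P_def by simp
    then show ?thesis using d x(3) by (intro exI[of _ "(x1, x2)"]) linarith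
  qed
  have P_pos: "?d x > 0" if "P x" for x
    using that pos by (cases x) (auto simp: P_def)
  obtain f :: "nat \<Rightarrow> int \<times> int" where f: "inj f" "\<And>n. P (f n)"
    using infinitely_many_of_arbitrarily_small[of P ?d, OF small P_pos] by blast
  have "inj (\<lambda>i. (fst (f i), snd (f i)))" using f(1) by simp
  then show ?thesis using f(2) unfolding P_def case_prod_beta
    by (intro exI[of _ "fst \<circ> f"] exI[of _ "snd \<circ> f"]) simp
qed

end
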